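(* Let $\mathscr{A}$ be the deleted $A_3$ arrangement in $\mathbb{K}^3$ (coordinates $x,y,z$), consisting of the five planes $\ker(y-z)$, $\ker y$, $\ker(x-y)$, $\ker x$, $\ker(x-z)$. Let $m:\mathscr{A}\to\mathbb{Z}_{\ge 0}$ be a multiplicity and let $a,b,c,d,e\ge 1$ be the values of $m+\mathbf{1}$ on $\ker(y-z)$, $\ker y$, $\ker(x-y)$, $\ker x$, $\ker(x-z)$, respectively. Then there exists an $m$-universal derivation $\theta\in D(\mathscr{A},m+\mathbf{1})$ if and only if $c=a+e-1=b+d-1$.
   Context: $\mathbb{K}$ is a field of characteristic zero, $S=\mathbb{K}[x,y,z]$, $\mathrm{Der}_S=S\partial_x\oplus S\partial_y\oplus S\partial_z$. For each hyperplane $H$ of $\mathscr{A}$ fix a linear form $\alpha_H$ with $\ker\alpha_H=H$. A multiplicity is a map $m:\mathscr{A}\to\mathbb{Z}_{\ge 0}$; $\mathbf{1}$ is the multiplicity with constant value $1$. $D(\mathscr{A},m)=\{\theta\in\mathrm{Der}_S\mid\theta(\alpha_H)\in S\alpha_H^{m(H)}\ \forall H\in\mathscr{A}\}$. A nonzero derivation $\theta$ is homogeneous of degree $k$ if every nonzero $\theta(\alpha)$, for $\alpha$ a linear form, is a homogeneous polynomial of degree $k$. For $\varphi\in\mathrm{Der}_S$ and $\theta=f_1\partial_x+f_2\partial_y+f_3\partial_z$ put $\nabla_\varphi\theta=\varphi(f_1)\partial_x+\varphi(f_2)\partial_y+\varphi(f_3)\partial_z$. A homogeneous $\theta\in D(\mathscr{A},m+\mathbf{1})$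 is $m$-universal if $\mathrm{Der}_S\to D(\mathscr{A},m)$, $\varphi\mapsto\nabla_\varphi\theta$, is an isomorphism of $S$-modules. *)

theory Defs
  imports "HOL-Computational_Algebra.Polynomial" "HOL-Library.Product_Plus"
begin

text \<open>
  The ring \<open>S = K[x,y,z]\<close> is taken as \<open>K[x][y][z]\<close>: \<open>x\<close> is the innermost variable and
  \<open>z\<close> the outermost one.
\<close>

type_synonym 'k poly3 = "'k poly poly poly"

definition X :: "'k::field_char_0 poly3" where "X = [:[:[:0, 1:]:]:]"
definition Y :: "'k::field_char_0 poly3" where "Y = [:[:0, 1:]:]"
definition Z :: "'k::field_char_0 poly3" where "Z = [:0, 1:]"

definition dx :: "'k::field_char_0 poly3 \<Rightarrow> 'k poly3" where "dx = map_poly (map_poly pderiv)"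
definition dy :: "'k::field_char_0 poly3 \<Rightarrow> 'k poly3" where "dy = map_poly pderiv"
definition dz :: "'k::field_char_0 poly3 \<Rightarrow> 'k poly3" where "dz = pderiv"

definition poly3 :: "'k::field_char_0 poly3 \<Rightarrow> 'k \<times> 'k \<times> 'k \<Rightarrow> 'k" where
  "poly3 p = (\<lambda>(u, v, w). poly (poly (poly p [:[:w:]:]) [:v:]) u)"

definition homogeneous_poly :: "nat \<Rightarrow> 'k::field_char_0 poly3 \<Rightarrow> bool" where
  "homogeneous_poly n p \<longleftrightarrow>
     (\<forall>i j l. coeff (coeff (coeff p l) j) i \<noteq> 0 \<longrightarrow> i + j + l = n)"

text \<open>A linear form is an element of \<open>S\<close> of the shape \<open>u x + v y + w z\<close>, possibly zero.\<close>

definition linear_form :: "'k::field_char_0 poly3 \<Rightarrow> bool" where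
  "linear_form p \<longleftrightarrow> homogeneous_poly 1 p"

definition form_ker :: "'k::field_char_0 poly3 \<Rightarrow> ('k \<times> 'k \<times> 'k) set" where
  "form_ker p = {v. poly3 p v = 0}"

text \<open>The triple \<open>(f, g, h)\<close> stands for the derivation \<open>f \<partial>\<^sub>x + g \<partial>\<^sub>y + h \<partial>\<^sub>z\<close>.\<close>

type_synonym 'k der = "'k poly3 \<times> 'k poly3 \<times> 'k poly3"

definition der_apply :: "'k::field_char_0 der \<Rightarrow> 'k poly3 \<Rightarrow> 'k poly3" where
  "der_apply = (\<lambda>(f, g, h) p. f * dx p + g * dy p + h * dz p)"

definition der_scale :: "'k::field_char_0 poly3 \<Rightarrow> 'k der \<Rightarrow> 'k der" where
  "der_scale s = (\<lambda>(f, g, h). (s * f, s * g, s * h))"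

definition nabla :: "'k::field_char_0 der \<Rightarrow> 'k der \<Rightarrow> 'k der" where
  "nabla \<phi> = (\<lambda>(f, g, h). (der_apply \<phi> f, der_apply \<phi> g, der_apply \<phi> h))"

definition homogeneous_der :: "nat \<Rightarrow> 'k::field_char_0 der \<Rightarrow> bool" where
  "homogeneous_der n \<theta> \<longleftrightarrow> \<theta> \<noteq> 0 \<and>
     (\<forall>\<alpha>. linear_form \<alpha> \<and> der_apply \<theta> \<alpha> \<noteq> 0 \<longrightarrow> homogeneous_poly n (der_apply \<theta> \<alpha>))"

text \<open>
  An arrangement is a set of planes in \<open>K\<^sup>3\<close>. Functions on it (the choice of defining forms,
  the multiplicities) are total functions on sets; only their values on members of the
  arrangement matter.
\<close>

type_synonym 'k plane = "('k \<times> 'k \<times> 'k) set"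

definition defining_forms :: "'k::field_char_0 plane set \<Rightarrow> ('k plane \<Rightarrow> 'k poly3) \<Rightarrow> bool" where
  "defining_forms A \<alpha> \<longleftrightarrow> (\<forall>H\<in>A. linear_form (\<alpha> H) \<and> form_ker (\<alpha> H) = H)"

definition log_der ::
  "'k::field_char_0 plane set \<Rightarrow> ('k plane \<Rightarrow> 'k poly3) \<Rightarrow> ('k plane \<Rightarrow> nat) \<Rightarrow> 'k der set" where
  "log_der A \<alpha> m = {\<theta>. \<forall>H\<in>A. \<alpha> H ^ m H dvd der_apply \<theta> (\<alpha> H)}"

text \<open>
  \<open>module_hom\<close> speaks about the ambient module of all derivations; together with \<open>bij_betw\<close>
  onto the submodule \<open>log_der A \<alpha> m\<close> it says that the map is an isomorphism of \<open>S\<close>-modules.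
\<close>

definition universal_der ::
  "'k::field_char_0 plane set \<Rightarrow> ('k plane \<Rightarrow> 'k poly3) \<Rightarrow> ('k plane \<Rightarrow> nat) \<Rightarrow> 'k der \<Rightarrow> bool" where
  "universal_der A \<alpha> m \<theta> \<longleftrightarrow>
     \<theta> \<in> log_der A \<alpha> (\<lambda>H. m H + 1) \<and>
     (\<exists>n. homogeneous_der n \<theta>) \<and>
     module_hom der_scale der_scale (\<lambda>\<phi>. nabla \<phi> \<theta>) \<and>
     bij_betw (\<lambda>\<phi>. nabla \<phi> \<theta>) UNIV (log_der A \<alpha> m)"

definition deleted_A3 :: "'k::field_char_0 plane set" where
  "deleted_A3 =
     {form_ker (Y - Z), form_ker Y, form_ker (X - Y), form_ker X, form_ker (X - Z)}"

end

theory Submission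
  imports Defs
begin

text \<open>
  Let \<open>a\<close>, \<open>b\<close>, \<open>c\<close>, \<open>d\<close>, \<open>e\<close> be the values of \<open>m\<close> itself (not of \<open>m + 1\<close>) on the kernels of \<open>y - z\<close>,
  \<open>y\<close>, \<open>x - y\<close>, \<open>x\<close>, \<open>x - z\<close>. The claim is then that a universal derivation exists if and only if
  \<open>c = a + e = b + d\<close>. A candidate is written \<open>\<theta> = f \<partial>\<^sub>x + g \<partial>\<^sub>y + h \<partial>\<^sub>z\<close>, of degree \<open>n\<close>.

  If the equations hold, let \<open>f\<close> be the part of the binomial expansion of \<open>(x - y)\<^bsup>c+1\<^esup>\<close> that is
  divisible by \<open>x\<^bsup>d+1\<^esup>\<close>; the rest is divisible by \<open>y\<^bsup>b+1\<^esup>\<close>. Put \<open>g = f - (x - y)\<^bsup>c+1\<^esup>\<close>, and obtain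
  \<open>h\<close> from \<open>f\<close> by subtracting the analogous part of the expansion in powers of \<open>x - z\<close> and \<open>y - z\<close>.
  The sum of the two partial derivatives of a truncated expansion telescopes to a monomial
  (\<open>derivation_truncated_binomial\<close>). This makes the system \<open>\<nabla>\<^sub>\<chi> \<theta> = \<eta>\<close> triangular, with diagonal
  entries \<open>(x - y)\<^bsup>c\<^esup>\<close>, \<open>x\<^bsup>d\<^esup> y\<^bsup>b\<^esup>\<close>, \<open>(x - z)\<^bsup>e\<^esup> (y - z)\<^bsup>a\<^esup>\<close> up to units, and the conditions that define
  \<open>D(A, m)\<close> are exactly those for its solvability (\<open>balanced_universal\<close>).

  Conversely, let \<open>\<theta>\<close> be universal. Surjectivity gives derivations \<open>\<phi>\<close>, \<open>\<psi>\<close> with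
  \<open>\<phi> f = \<phi> g = \<phi> h = F\<close> and \<open>\<psi> f = \<psi> g = 0\<close>, \<open>\<psi> h = G\<close>, where \<open>F = x\<^bsup>d\<^esup> y\<^bsup>b\<^esup>\<close> and
  \<open>G = (x - z)\<^bsup>e\<^esup> (y - z)\<^bsup>a\<^esup>\<close>. The heart of the proof is that \<open>f\<close> and \<open>g\<close> do not involve \<open>z\<close>.
  A linear form that divides a nonzero polynomial killed by a derivation divides its own image
  under this derivation. Hence \<open>\<psi>\<close> is parallel to the line \<open>x = y = 0\<close> along this line, and \<open>h\<close> does
  not vanish on it; likewise \<open>f\<close> does not vanish on the line \<open>x = y = z\<close>. Applying \<open>\<phi>\<close>, \<open>\<psi>\<close> and a
  third derivation to \<open>f\<close>, \<open>f - g\<close>, \<open>h\<close> shows that the Jacobian determinant of the latter, divided by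
  \<open>(x - y)\<^bsup>c\<^esup>\<close>, divides a product of powers of \<open>x\<close>, \<open>y\<close>, \<open>x - z\<close>, \<open>y - z\<close> (\<open>J_multiple\<close>). Restricted to
  the line \<open>x = y = 1\<close> it is, up to a factor, the Wronskian of the restrictions of \<open>f\<close> and \<open>h\<close>, which
  therefore vanishes at most at \<open>z = 1\<close>. Comparing its degree with the order of this zero shows
  that \<open>f\<close> is constant on the line \<open>x = y = 1\<close> (\<open>wronskian_dvd_power_imp_const\<close>).

  Suppose that \<open>z\<close> does occur in \<open>f\<close> or \<open>g\<close>, let \<open>N\<close> be its highest exponent in either, and let \<open>p\<close>,
  \<open>q\<close> be the coefficients of \<open>z\<^sup>N\<close> in \<open>f\<close>, \<open>g\<close>. By the previous step \<open>p\<close> vanishes at \<open>x = y = 1\<close>. If the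
  Jacobian of \<open>p\<close> and \<open>q\<close> is nonzero, then, divided by \<open>(x - y)\<^bsup>c\<^esup>\<close>, it is up to a constant the
  leading coefficient in \<open>z\<close> of the reduced Jacobian determinant, and so it divides a monomial in
  \<open>x\<close> and \<open>y\<close>; but it vanishes at \<open>x = y = 1\<close>. So the Jacobian is zero (\<open>initial_jacobian\<close>), and \<open>p\<close>,
  \<open>q\<close> are multiples of one form. At least two of the factors \<open>x\<close>, \<open>y\<close>, \<open>x - y\<close> can be cancelled from
  this form at the cost of lowering the multiplicities from \<open>m + 1\<close> to \<open>m\<close>. Multiplied by \<open>G\<close>, the
  result gives an element of \<open>D(A, m)\<close> whose order along the line \<open>x = y = 0\<close> is smaller than
  that of any \<open>\<nabla>\<^sub>\<chi> \<theta>\<close>, a contradiction (\<open>no_z\<close>).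

  Once \<open>f\<close> and \<open>g\<close> are free of \<open>z\<close>, the derivative of \<open>h\<close> by \<open>z\<close> is a constant multiple of \<open>G\<close>, so
  \<open>n = a + e + 1\<close>; comparison of \<open>h\<close> with the truncated expansion gives \<open>f - g = k (x - y)\<^sup>n\<close> with a
  constant \<open>k\<close>, so \<open>n = c + 1\<close>; and \<open>\<partial>\<^sub>x f + \<partial>\<^sub>y f\<close> is a constant multiple of \<open>F\<close>, so \<open>n = b + d + 1\<close>.
\<close>

section \<open>Derivations of commutative rings\<close>

text \<open>Additive maps with the Leibniz rule; linearity over a subring is not part of the notion.\<close>

definition derivation :: "('a::comm_ring_1 \<Rightarrow> 'a) \<Rightarrow> bool" where
  "derivation D \<longleftrightarrow>
     (\<forall>p q. D (p + q) = D p + D q) \<and> (\<forall>p q. D (p * q) = D p * q + p * D q)"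

lemma derivation_add: "derivation D \<Longrightarrow> D (p + q) = D p + D q"
  by (simp add: derivation_def)

lemma derivation_mult: "derivation D \<Longrightarrow> D (p * q) = D p * q + p * D q"
  by (simp add: derivation_def)

lemma derivation_0: "derivation D \<Longrightarrow> D 0 = 0"
  using derivation_add[of D 0 0] by simp

lemma derivation_1: "derivation D \<Longrightarrow> D 1 = 0"
  using derivation_mult[of D 1 1] by simp

lemma derivation_uminus: "derivation D \<Longrightarrow> D (- p) = - D p"
  using derivation_add[of D p "- p"] by (simp add: derivation_0 add_eq_0_iff2)

lemma derivation_diff: "derivation D \<Longrightarrow> D (p - q) = D p - D q"
  using derivation_add[of D p "- q"] by (simp add: derivation_uminus)

lemma derivation_sum: "derivation D \<Longrightarrow> D (sum F A) = (\<Sum>i\<in>A. D (F i))"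
  by (induction A rule: infinite_finite_induct) (simp_all add: derivation_0 derivation_add)

lemma derivation_of_nat: "derivation D \<Longrightarrow> D (of_nat n) = 0"
  by (induction n) (simp_all add: derivation_0 derivation_add derivation_1)

lemma derivation_power: "derivation D \<Longrightarrow> D (p ^ n) = of_nat n * p ^ (n - 1) * D p"
proof (induction n)
  case (Suc n)
  have "p * (of_nat n * p ^ (n - 1) * D p) = of_nat n * p ^ n * D p"
    by (cases n) (simp_all add: ac_simps)
  then show ?case using Suc by (simp add: derivation_mult algebra_simps)
qed (simp add: derivation_1)

lemma derivation_power_mult:
  assumes "derivation D"
  shows "D (L ^ Suc k * q) = L ^ k * (of_nat (Suc k) * D L * q + L * D q)"
proof -
  have "D (L ^ Suc k) = of_nat (Suc k) * L ^ k * D L"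
    using derivation_power[OF assms, of L "Suc k"] by (simp only: diff_Suc_1)
  then have "D (L ^ Suc k * q) = of_nat (Suc k) * L ^ k * D L * q + L ^ Suc k * D q"
    by (simp only: derivation_mult[OF assms, of "L ^ Suc k"])
  also have "\<dots> = L ^ k * (of_nat (Suc k) * D L * q + L * D q)"
    by (simp only: power_Suc distrib_left ac_simps)
  finally show ?thesis .
qed

lemma power_dvd_derivation:
  assumes "derivation D" "L ^ Suc k dvd p"
  shows "L ^ k dvd D p"
proof -
  obtain q where "p = L ^ Suc k * q" using assms(2) by blast
  then have "D p = L ^ k * (of_nat (Suc k) * D L * q + L * D q)"
    using derivation_power_mult[OF assms(1)] by simp
  then show ?thesis by simp
qed

lemma derivation_map_poly:
  assumes "derivation D"
  shows "derivation (map_poly D)"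
  unfolding derivation_def
  by (auto simp: poly_eq_iff coeff_map_poly derivation_0[OF assms] coeff_mult
      derivation_add[OF assms] derivation_sum[OF assms] derivation_mult[OF assms] sum.distrib)

lemma derivation_pderiv: "derivation (pderiv :: 'a::idom poly \<Rightarrow> _)"
  by (simp add: derivation_def pderiv_add pderiv_mult)

lemma derivation_dx: "derivation dx"
  unfolding dx_def by (intro derivation_map_poly derivation_pderiv)

lemma derivation_dy: "derivation dy"
  unfolding dy_def by (intro derivation_map_poly derivation_pderiv)

lemma derivation_dz: "derivation dz"
  unfolding dz_def by (intro derivation_pderiv)

lemma derivation_der_apply: "derivation (der_apply \<chi>)"
  by (cases \<chi>) (simp add: derivation_def der_apply_def algebra_simps
      derivation_add[OF derivation_dx] derivation_mult[OF derivation_dx]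
      derivation_add[OF derivation_dy] derivation_mult[OF derivation_dy]
      derivation_add[OF derivation_dz] derivation_mult[OF derivation_dz])

text \<open>
  Comparing powers of \<open>L\<close> in \<open>0 = D (L\<^sup>i F)\<close>, where \<open>L\<close> does not divide \<open>F\<close>, shows that \<open>L\<close> divides
  \<open>D L\<close>. The bound \<open>B\<close> makes the multiplicity \<open>i\<close> of \<open>L\<close> in \<open>f\<close> finite and forces \<open>f \<noteq> 0\<close>.
\<close>

lemma prime_dvd_derivation:
  fixes f :: "'a::{idom, algebraic_semidom}"
  assumes D: "derivation D" "D f = 0"
    and L: "prime_elem L" "L dvd f" "\<And>i. L ^ i dvd f \<Longrightarrow> i \<le> B"
    and unit: "\<And>i. is_unit (of_nat (Suc i) :: 'a)"
  shows "L dvd D L"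
proof -
  define i where "i = Max {i. L ^ i dvd f}"
  have fin: "finite {i. L ^ i dvd f}"
    using L(3) by (auto intro!: finite_subset[of _ "{..B}"])
  have i: "L ^ i dvd f"
  proof -
    have "0 \<in> {i. L ^ i dvd f}" by simp
    then show ?thesis using Max_in[OF fin] unfolding i_def by blast
  qed
  have "1 \<le> i" unfolding i_def using L(2) by (intro Max_ge[OF fin]) simp
  then obtain k where k: "i = Suc k" by (cases i) auto
  obtain F where F: "f = L ^ i * F" using i by blast
  have nd: "\<not> L dvd F"
  proof
    assume "L dvd F"
    then have "L ^ Suc i dvd f" unfolding F power_Suc2 by (rule mult_dvd_mono[OF dvd_refl])
    then have "Suc i \<le> i" unfolding i_def by (intro Max_ge[OF fin]) (simp add: i_def)
    then show False by simp
  qed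
  have "0 = D f" by (simp add: D)
  also have "\<dots> = L ^ k * (of_nat (Suc k) * D L * F + L * D F)"
    unfolding F k by (rule derivation_power_mult[OF D(1)])
  finally have "L ^ k * (of_nat (Suc k) * D L * F + L * D F) = 0" by (rule sym)
  moreover have "L ^ k \<noteq> 0" using L(1) by (simp add: prime_elem_not_zeroI)
  ultimately have "of_nat (Suc k) * D L * F + L * D F = 0"
    by (simp only: mult_eq_0_iff simp_thms)
  then have "of_nat (Suc k) * D L * F = L * (- D F)"
    by (simp only: mult_minus_right eq_neg_iff_add_eq_0)
  then have "L dvd of_nat (Suc k) * (D L * F)"
    by (simp only: mult.assoc dvd_triv_left)
  then have "L dvd D L * F"
    using dvd_mult_unit_iff'[OF unit[of k]] by blast
  then show ?thesis using nd L(1) by (simp add: prime_elem_dvd_mult_iff)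
qed

lemma prime_power_mult_dvd:
  fixes p q :: "'a::{idom, algebraic_semidom}"
  assumes "prime_elem p" "\<not> p dvd q" "p ^ i dvd A" "q dvd A"
  shows "p ^ i * q dvd A"
proof -
  obtain B where B: "A = q * B" using assms(4) by blast
  then have "p ^ i dvd B"
    using prime_elem_power_dvd_cases[of p i q B 1 i] assms(1-3) by auto
  then show ?thesis unfolding B mult.commute[of "p ^ i"] by (rule mult_dvd_mono[OF dvd_refl])
qed

section \<open>Coefficients, homogeneity and divisibility in three variables\<close>

lemma dx_XYZ [simp]: "dx X = 1" "dx Y = 0" "dx Z = 0"
  by (simp_all add: dx_def X_def Y_def Z_def map_poly_pCons pderiv_pCons one_pCons)

lemma dy_XYZ [simp]: "dy X = 0" "dy Y = 1" "dy Z = 0"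
  by (simp_all add: dy_def X_def Y_def Z_def map_poly_pCons pderiv_pCons one_pCons)

lemma dz_XYZ [simp]: "dz X = 0" "dz Y = 0" "dz Z = 1"
  by (simp_all add: dz_def X_def Y_def Z_def pderiv_pCons one_pCons)

lemma coeff_of_nat_mult: "coeff (of_nat n * p) l = of_nat n * coeff p l"
  by (simp add: of_nat_poly)

lemma coeff_dx: "coeff (dx p) l = map_poly pderiv (coeff p l)"
  by (simp add: dx_def coeff_map_poly)

lemma coeff_dy: "coeff (dy p) l = pderiv (coeff p l)"
  by (simp add: dy_def coeff_map_poly)

lemma coeff_dz: "coeff (dz p) l = of_nat (Suc l) * coeff p (Suc l)"
  by (simp add: dz_def coeff_pderiv)

text \<open>Restriction of a polynomial to the line \<open>x = u, y = v\<close>, with parameter \<open>z\<close>.\<close>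

definition on_line :: "'k \<Rightarrow> 'k \<Rightarrow> 'k::field_char_0 poly3 \<Rightarrow> 'k poly" where
  "on_line u v p = map_poly (\<lambda>q. poly (poly q [:v:]) u) p"

lemma coeff_on_line: "coeff (on_line u v p) l = poly (poly (coeff p l) [:v:]) u"
  by (simp add: on_line_def coeff_map_poly)

lemma on_line_add [simp]: "on_line u v (p + q) = on_line u v p + on_line u v q"
  by (simp add: poly_eq_iff coeff_on_line)

lemma on_line_diff [simp]: "on_line u v (p - q) = on_line u v p - on_line u v q"
  by (simp add: poly_eq_iff coeff_on_line)

lemma on_line_uminus [simp]: "on_line u v (- p) = - on_line u v p"
  by (simp add: poly_eq_iff coeff_on_line)

lemma on_line_mult [simp]: "on_line u v (p * q) = on_line u v p * on_line u v q"
  by (simp add: poly_eq_iff coeff_on_line coeff_mult poly_sum)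

lemma on_line_0 [simp]: "on_line u v 0 = 0"
  by (simp add: on_line_def)

lemma on_line_1 [simp]: "on_line u v 1 = 1"
  by (simp add: on_line_def)

lemma on_line_of_nat [simp]: "on_line u v (of_nat n) = of_nat n"
  by (induction n) simp_all

lemma on_line_power [simp]: "on_line u v (p ^ n) = on_line u v p ^ n"
  by (induction n) simp_all

lemma on_line_dvd: "p dvd q \<Longrightarrow> on_line u v p dvd on_line u v q"
  by (auto simp: dvd_def)

lemma on_line_XYZ [simp]: "on_line u v X = [:u:]" "on_line u v Y = [:v:]" "on_line u v Z = [:0, 1:]"
  by (simp_all add: on_line_def X_def Y_def Z_def map_poly_pCons)

lemma on_line_dz: "on_line u v (dz p) = pderiv (on_line u v p)"
  by (simp add: poly_eq_iff coeff_on_line coeff_dz coeff_pderiv of_nat_poly)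

lemma coeff_X_mult: "coeff (X * p) l = [:[:0, 1:]:] * coeff p l"
  by (simp add: X_def)

lemma coeff_Y_mult: "coeff (Y * p) l = [:0, 1:] * coeff p l"
  by (simp add: Y_def)

lemma coeff_Z_mult: "coeff (Z * p) l = (case l of 0 \<Rightarrow> 0 | Suc l' \<Rightarrow> coeff p l')"
  by (simp add: Z_def coeff_pCons split: nat.splits)

subsection \<open>Homogeneous polynomials\<close>

lemma homogeneous_polyD:
  "homogeneous_poly n p \<Longrightarrow> i + j + l \<noteq> n \<Longrightarrow> coeff (coeff (coeff p l) j) i = 0"
  by (auto simp: homogeneous_poly_def)

lemma homogeneous_poly_degree: "homogeneous_poly n p \<Longrightarrow> degree p \<le> n"
  by (intro degree_le allI impI poly_eqI) (simp add: homogeneous_polyD)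

lemma homogeneous_euler:
  assumes "homogeneous_poly n p"
  shows "X * dx p + Y * dy p + Z * dz p = of_nat n * p"
proof (intro poly_eqI)
  fix i j l
  have "coeff (coeff (coeff (X * dx p) l) j) i = of_nat i * coeff (coeff (coeff p l) j) i"
    by (simp add: coeff_X_mult coeff_dx coeff_map_poly coeff_pCons coeff_pderiv split: nat.splits)
  moreover have "coeff (coeff (coeff (Y * dy p) l) j) i = of_nat j * coeff (coeff (coeff p l) j) i"
    by (simp add: coeff_Y_mult coeff_dy coeff_pCons coeff_pderiv coeff_of_nat_mult
        del: of_nat_Suc split: nat.splits)
  moreover have "coeff (coeff (coeff (Z * dz p) l) j) i = of_nat l * coeff (coeff (coeff p l) j) i"
    by (simp add: coeff_Z_mult coeff_dz coeff_of_nat_mult del: of_nat_Suc split: nat.splits)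
  ultimately have "coeff (coeff (coeff (X * dx p + Y * dy p + Z * dz p) l) j) i =
      (of_nat i + of_nat j + of_nat l) * coeff (coeff (coeff p l) j) i"
    by (simp only: coeff_add distrib_right)
  also have "\<dots> = of_nat n * coeff (coeff (coeff p l) j) i"
    using homogeneous_polyD[OF assms, of i j l] by (cases "i + j + l = n") auto
  finally show "coeff (coeff (coeff (X * dx p + Y * dy p + Z * dz p) l) j) i =
      coeff (coeff (coeff (of_nat n * p) l) j) i"
    by (simp only: coeff_of_nat_mult)
qed

text \<open>
  In terms of the coefficient of \<open>z\<^sup>l\<close>, which is homogeneous of degree \<open>n - l\<close> in \<open>x\<close> and \<open>y\<close>.
\<close>

lemma homogeneous_euler_coeff:
  assumes "homogeneous_poly n p" "l \<le> n"
  shows "[:[:0, 1:]:] * coeff (dx p) l + [:0, 1:] * coeff (dy p) l = of_nat (n - l) * coeff p l"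
proof -
  have "coeff (Z * dz p) l = of_nat l * coeff p l"
    by (cases l) (simp_all add: coeff_Z_mult coeff_dz del: of_nat_Suc)
  then have "[:[:0, 1:]:] * coeff (dx p) l + [:0, 1:] * coeff (dy p) l + of_nat l * coeff p l =
      of_nat n * coeff p l"
    using arg_cong[OF homogeneous_euler[OF assms(1)], of "\<lambda>q. coeff q l"]
    by (simp only: coeff_add coeff_X_mult coeff_Y_mult coeff_of_nat_mult)
  then show ?thesis using assms(2) by (simp add: of_nat_diff algebra_simps)
qed

lemma homogeneous_poly_0 [simp]: "homogeneous_poly n 0"
  by (simp add: homogeneous_poly_def)

lemma homogeneous_poly_add:
  assumes "homogeneous_poly n p" "homogeneous_poly n q"
  shows "homogeneous_poly n (p + q)"
  unfolding homogeneous_poly_def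
proof (intro allI impI)
  fix i j l assume "coeff (coeff (coeff (p + q) l) j) i \<noteq> 0"
  then have "coeff (coeff (coeff p l) j) i \<noteq> 0 \<or> coeff (coeff (coeff q l) j) i \<noteq> 0" by auto
  then show "i + j + l = n" using assms by (auto simp: homogeneous_poly_def)
qed

lemma homogeneous_poly_uminus: "homogeneous_poly n p \<Longrightarrow> homogeneous_poly n (- p)"
  by (simp add: homogeneous_poly_def)

lemma homogeneous_poly_diff:
  "homogeneous_poly n p \<Longrightarrow> homogeneous_poly n q \<Longrightarrow> homogeneous_poly n (p - q)"
  using homogeneous_poly_add[of n p "- q"] by (simp add: homogeneous_poly_uminus)

lemma homogeneous_poly_sum:
  "(\<And>i. i \<in> A \<Longrightarrow> homogeneous_poly n (F i)) \<Longrightarrow> homogeneous_poly n (sum F A)"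
  by (induction A rule: infinite_finite_induct) (simp_all add: homogeneous_poly_add)

lemma homogeneous_poly_mult:
  assumes "homogeneous_poly m p" "homogeneous_poly n q"
  shows "homogeneous_poly (m + n) (p * q)"
  unfolding homogeneous_poly_def
proof (intro allI impI, rule ccontr)
  fix i j l
  assume nz: "coeff (coeff (coeff (p * q) l) j) i \<noteq> 0" and ne: "i + j + l \<noteq> m + n"
  have "coeff (coeff (coeff p l') j') i' *
      coeff (coeff (coeff q (l - l')) (j - j')) (i - i') = 0"
    if "l' \<le> l" "j' \<le> j" "i' \<le> i" for i' j' l'
  proof (cases "i' + j' + l' = m")
    case True
    then have "(i - i') + (j - j') + (l - l') \<noteq> n" using ne that by linarith
    then show ?thesis using homogeneous_polyD[OF assms(2)] by simp
  next
    case False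
    then show ?thesis using homogeneous_polyD[OF assms(1)] by simp
  qed
  then have "coeff (coeff (coeff (p * q) l) j) i = 0"
    unfolding coeff_mult coeff_sum by (intro sum.neutral ballI) auto
  then show False using nz by simp
qed

lemma homogeneous_poly_of_nat: "homogeneous_poly 0 (of_nat n)"
  by (auto simp: homogeneous_poly_def of_nat_poly coeff_pCons split: nat.splits)

lemma homogeneous_poly_power: "homogeneous_poly m p \<Longrightarrow> homogeneous_poly (m * n) (p ^ n)"
proof (induction n)
  case 0
  show ?case using homogeneous_poly_of_nat[of 1] by simp
next
  case (Suc n)
  then show ?case using homogeneous_poly_mult[of m p "m * n" "p ^ n"] by simp
qed

lemma homogeneous_poly_XYZ:
  "homogeneous_poly 1 X" "homogeneous_poly 1 Y" "homogeneous_poly 1 Z"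
  by (auto simp: homogeneous_poly_def X_def Y_def Z_def coeff_pCons split: nat.splits)

lemma homogeneous_poly_partials:
  assumes "homogeneous_poly (Suc n) p"
  shows "homogeneous_poly n (dx p)" "homogeneous_poly n (dy p)" "homogeneous_poly n (dz p)"
proof -
  have "i + j + l = n" if "coeff (coeff (coeff (dx p) l) j) i \<noteq> 0" for i j l
    using that homogeneous_polyD[OF assms, of "Suc i" j l]
    by (auto simp: coeff_dx coeff_map_poly coeff_pderiv)
  moreover have "i + j + l = n" if "coeff (coeff (coeff (dy p) l) j) i \<noteq> 0" for i j l
    using that homogeneous_polyD[OF assms, of i "Suc j" l]
    by (auto simp: coeff_dy coeff_pderiv coeff_of_nat_mult simp del: of_nat_Suc)
  moreover have "i + j + l = n" if "coeff (coeff (coeff (dz p) l) j) i \<noteq> 0" for i j l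
    using that homogeneous_polyD[OF assms, of i j "Suc l"]
    by (auto simp: coeff_dz coeff_of_nat_mult simp del: of_nat_Suc)
  ultimately show "homogeneous_poly n (dx p)" "homogeneous_poly n (dy p)" "homogeneous_poly n (dz p)"
    by (simp_all add: homogeneous_poly_def)
qed

lemma homogeneous_poly_unique:
  assumes "homogeneous_poly m p" "homogeneous_poly n p" "p \<noteq> 0"
  shows "m = n"
proof -
  obtain i j l where "coeff (coeff (coeff p l) j) i \<noteq> 0"
    using assms(3) by (metis leading_coeff_0_iff)
  then show ?thesis using assms(1,2) by (metis homogeneous_poly_def)
qed

subsection \<open>Units\<close>

lemma is_unit_of_nat_poly3: "is_unit (of_nat (Suc n) :: 'k::field_char_0 poly3)"
proof -
  have "of_nat (Suc n) * [:[:[:inverse (of_nat (Suc n)) :: 'k:]:]:] = 1"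
    by (simp add: of_nat_poly one_pCons del: of_nat_Suc)
  then show ?thesis by (rule dvdI[OF sym])
qed

lemma unit_poly3:
  assumes "is_unit (u :: 'k::field_char_0 poly3)"
  obtains k where "u = [:[:[:k:]:]:]" "k \<noteq> 0"
proof -
  obtain u1 where u1: "u = [:u1:]" "is_unit u1" using assms by (auto simp: is_unit_poly_iff)
  then obtain u2 where u2: "u1 = [:u2:]" "is_unit u2" by (auto simp: is_unit_poly_iff)
  then obtain k where k: "u2 = [:k:]" "k dvd 1" by (auto simp: is_unit_poly_iff)
  have "k \<noteq> 0" using k(2) by auto
  then show thesis using that u1 u2 k by simp
qed

lemma derivation_unit_poly3:
  assumes "is_unit (u :: 'k::field_char_0 poly3)"
  shows "dx u = 0" "dy u = 0" "dz u = 0"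
  using assms by (auto elim!: unit_poly3 simp: dx_def dy_def dz_def map_poly_pCons pderiv_pCons)

lemma homogeneous_unit_poly3: "is_unit u \<Longrightarrow> homogeneous_poly 0 u"
  by (auto elim!: unit_poly3 simp: homogeneous_poly_def coeff_pCons split: nat.splits)

subsection \<open>The five linear forms are prime\<close>

lemma prime_elem_uminus: "prime_elem (- p) \<longleftrightarrow> prime_elem (p::'a::idom)"
  by (simp add: prime_elem_def)

lemma prime_elem_root: "prime_elem [:- a, 1 :: 'a::idom:]"
  by (rule prime_elemI) (auto simp: poly_eq_0_iff_dvd[symmetric])

lemma prime_elem_X: "prime_elem (X :: 'k::field_char_0 poly3)"
  using prime_elem_root[of "0 :: 'k::field_char_0"] by (simp add: X_def lift_prime_elem_poly)

lemma prime_elem_Y: "prime_elem (Y :: 'k::field_char_0 poly3)"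
  using prime_elem_root[of "0 :: 'k::field_char_0 poly"] by (simp add: Y_def lift_prime_elem_poly)

lemma prime_elem_X_minus_Z: "prime_elem (X - Z :: 'k::field_char_0 poly3)"
  using prime_elem_root[of "[:[:0, 1:]:] :: 'k poly poly"] prime_elem_uminus[of "X - Z :: 'k poly3"]
  by (simp add: X_def Z_def)

lemma prime_elem_Y_minus_Z: "prime_elem (Y - Z :: 'k::field_char_0 poly3)"
  using prime_elem_root[of "[:0, 1:] :: 'k poly poly"] prime_elem_uminus[of "Y - Z :: 'k poly3"]
  by (simp add: Y_def Z_def)

text \<open>
  The sum of the three exponents of the lexicographically leading monomial; it turns products
  of nonzero polynomials into sums.
\<close>

definition lex_degree :: "'k::field_char_0 poly3 \<Rightarrow> nat" where
  "lex_degree p = degree p + degree (lead_coeff p) + degree (lead_coeff (lead_coeff p))"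

lemma lex_degree_mult:
  "p \<noteq> 0 \<Longrightarrow> q \<noteq> 0 \<Longrightarrow> lex_degree (p * q) = lex_degree p + lex_degree q"
  unfolding lex_degree_def lead_coeff_mult by (simp add: degree_mult_eq)

lemma lex_degree_power: "p \<noteq> 0 \<Longrightarrow> lex_degree (p ^ n) = n * lex_degree p"
proof (induction n)
  case 0
  then show ?case by (simp add: lex_degree_def)
next
  case (Suc n)
  then show ?case by (simp add: lex_degree_mult)
qed

lemma power_dvd_le_lex_degree:
  assumes "L ^ i dvd f" "f \<noteq> 0" "lex_degree L \<ge> 1"
  shows "i \<le> lex_degree f"
proof -
  obtain g where g: "f = L ^ i * g" using assms(1) by blast
  then have "L ^ i \<noteq> 0" "g \<noteq> 0" using assms(2) by auto
  then have "lex_degree f = lex_degree (L ^ i) + lex_degree g"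
    unfolding g by (rule lex_degree_mult)
  moreover have "lex_degree (L ^ i) = i * lex_degree L"
    using assms(3) by (intro lex_degree_power) (auto simp: lex_degree_def)
  ultimately show ?thesis using mult_le_mono2[OF assms(3), of i] by linarith
qed

lemma lex_degree_forms:
  "lex_degree X = 1" "lex_degree Y = 1" "lex_degree (X - Z) = 1" "lex_degree (Y - Z) = 1"
  by (simp_all add: lex_degree_def X_def Y_def Z_def)

lemma prime_form_dvd_derivation:
  fixes f :: "'k::field_char_0 poly3"
  assumes "derivation D" "D f = 0" "f \<noteq> 0" "prime_elem L" "lex_degree L = 1" "L dvd f"
  shows "L dvd D L"
  using assms power_dvd_le_lex_degree[of L _ f]
  by (intro prime_dvd_derivation[of D f L "lex_degree f"] is_unit_of_nat_poly3) auto

subsection \<open>Order of vanishing at the origin of the plane\<close>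

text \<open>\<open>q \<in> K[x,y]\<close> has no monomial of degree less than \<open>r\<close>.\<close>

definition order_ge :: "nat \<Rightarrow> 'k::field_char_0 poly poly \<Rightarrow> bool" where
  "order_ge r q \<longleftrightarrow> (\<forall>i j. i + j < r \<longrightarrow> coeff (coeff q j) i = 0)"

lemma order_ge_add: "order_ge r p \<Longrightarrow> order_ge r q \<Longrightarrow> order_ge r (p + q)"
  by (simp add: order_ge_def)

lemma order_ge_sum: "(\<And>i. i \<in> A \<Longrightarrow> order_ge r (F i)) \<Longrightarrow> order_ge r (sum F A)"
  by (simp add: order_ge_def coeff_sum)

lemma order_ge_mult:
  assumes "order_ge r p" "order_ge s q"
  shows "order_ge (r + s) (p * q)"
  unfolding order_ge_def
proof (intro allI impI)
  fix i j assume ij: "i + j < r + s"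
  have "coeff (coeff p j') i' * coeff (coeff q (j - j')) (i - i') = 0"
    if "j' \<le> j" "i' \<le> i" for i' j'
  proof (cases "i' + j' < r")
    case True
    then show ?thesis using assms(1) by (simp add: order_ge_def)
  next
    case False
    then have "(i - i') + (j - j') < s" using ij that by linarith
    then show ?thesis using assms(2) by (simp add: order_ge_def)
  qed
  then show "coeff (coeff (p * q) j) i = 0"
    unfolding coeff_mult coeff_sum by (intro sum.neutral ballI) auto
qed

lemma order_ge_zero [simp]: "order_ge 0 q"
  by (simp add: order_ge_def)

lemma order_ge_mult_left: "order_ge s q \<Longrightarrow> order_ge s (p * q)"
  using order_ge_mult[of 0 p s q] by simp

lemma order_ge_x: "order_ge 1 [:[:0, 1:]:]"
  and order_ge_y: "order_ge 1 [:0, 1:]"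
  and order_ge_x_minus_y: "order_ge 1 ([:[:0, 1:]:] - [:0, 1:])"
  by (auto simp: order_ge_def coeff_pCons split: nat.splits)

subsection \<open>Wronskians of two polynomials\<close>

lemma coeff_mult_top:
  assumes "degree p \<le> m" "degree q \<le> n"
  shows "coeff (p * q) (m + n) = coeff p m * coeff q n"
proof -
  have "coeff p i * coeff q (m + n - i) = 0" if "i \<noteq> m" for i
    using that assms by (cases "i < m") (simp_all add: coeff_eq_0)
  then have "(\<Sum>i\<le>m + n. coeff p i * coeff q (m + n - i)) =
      (\<Sum>i\<in>{m}. coeff p i * coeff q (m + n - i))"
    by (intro sum.mono_neutral_right) auto
  then show ?thesis by (simp add: coeff_mult)
qed

lemma coeff_mult_pderiv_top:
  assumes "degree p \<le> m" "degree q \<le> n" "m + n > 0"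
  shows "coeff (p * pderiv q) (m + n - 1) = of_nat n * (coeff p m * coeff q n)"
proof (cases n)
  case 0
  then have "pderiv q = 0" using assms(2) by (intro poly_eqI) (simp add: coeff_pderiv coeff_eq_0)
  then show ?thesis using 0 by simp
next
  case (Suc k)
  have "degree (pderiv q) \<le> k"
    using assms(2) Suc by (intro degree_le) (simp add: coeff_pderiv coeff_eq_0)
  then show ?thesis using coeff_mult_top[OF assms(1), of "pderiv q" k] Suc
    by (simp add: coeff_pderiv mult.left_commute del: of_nat_Suc)
qed

lemma wronskian_zero_degree:
  fixes p q :: "'a::{idom, ring_char_0} poly"
  assumes "p * pderiv q = q * pderiv p" "p \<noteq> 0" "q \<noteq> 0"
  shows "degree p = degree q"
proof (cases "degree p + degree q > 0")
  case True
  have "of_nat (degree q) * (lead_coeff p * lead_coeff q) =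
      (of_nat (degree p) * (lead_coeff p * lead_coeff q) :: 'a)"
    using coeff_mult_pderiv_top[of p "degree p" q "degree q"]
      coeff_mult_pderiv_top[of q "degree q" p "degree p"] True assms(1)
    by (simp add: ac_simps)
  then show ?thesis using assms(2,3) by simp
qed simp

text \<open>
  Let \<open>degree q = n\<close>. The Wronskian of \<open>p\<close> and \<open>q\<close> has degree \<open>degree p + n - 1\<close>, which is at least
  \<open>n\<close> unless \<open>p\<close> is constant. As all its zeros are at \<open>1\<close>, it vanishes there to order at least \<open>n\<close>.
  Up to sign it is also the Wronskian of \<open>p\<close> and \<open>p - q\<close>, where \<open>p\<close> is nonzero at \<open>1\<close>, so the zero
  of \<open>p - q\<close> at \<open>1\<close> would have an order greater than \<open>n\<close>, which is the degree of \<open>p - q\<close>.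
\<close>

lemma wronskian_dvd_power_imp_const:
  fixes p q :: "'k::field_char_0 poly"
  assumes deg: "degree p < degree q" and p1: "poly p 1 \<noteq> 0" and pq: "poly p 1 = poly q 1"
    and W: "p * pderiv q - q * pderiv p dvd [:-1, 1:] ^ L"
  shows "degree p = 0"
proof (rule ccontr)
  assume "degree p \<noteq> 0"
  define n W o' where "n = degree q" and "W = p * pderiv q - q * pderiv p" and "o' = order 1 W"
  have "p \<noteq> 0" "q \<noteq> 0" using p1 deg by auto
  have "coeff W (degree p + n - 1) =
      (of_nat n - of_nat (degree p)) * (lead_coeff p * lead_coeff q)"
    using coeff_mult_pderiv_top[of p "degree p" q n] coeff_mult_pderiv_top[of q n p "degree p"] deg
    by (simp add: W_def n_def algebra_simps)
  also have "\<dots> \<noteq> 0" using deg \<open>p \<noteq> 0\<close> \<open>q \<noteq> 0\<close> by (simp add: n_def)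
  finally have "degree W \<ge> degree p + n - 1" by (rule le_degree)
  then have degW: "degree W \<ge> n" using \<open>degree p \<noteq> 0\<close> by simp
  obtain V where V: "[:-1, 1:] ^ L = W * V" using W unfolding W_def by blast
  have "W * V \<noteq> 0" using V[symmetric] by (simp del: mult_eq_0_iff)
  then have nz: "W \<noteq> 0" "V \<noteq> 0" by auto
  then obtain W' where W': "W = [:- 1, 1:] ^ o' * W'" "\<not> [:- 1, 1:] dvd W'"
    unfolding o'_def using order_decomp[of W 1] by blast
  have split: "[:-1, 1:] ^ L = W' * ([:- 1, 1:] ^ o' * V)"
    using V unfolding W'(1) by (simp only: ac_simps)
  then have "[:-1, 1:] ^ L dvd W' * ([:- 1, 1:] ^ o' * V)" by (rule ssubst) (rule dvd_refl)
  then have "[:-1, 1:] ^ L dvd [:- 1, 1:] ^ o' * V"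
    using prime_elem_power_dvd_cases[of "[:-1, 1:]" L W' "[:- 1, 1:] ^ o' * V" 1 L] W'(2)
      prime_elem_root[of "1::'k"] by auto
  then obtain U where U: "[:- 1, 1:] ^ o' * V = [:-1, 1:] ^ L * U" by blast
  have "[:-1, 1:] ^ L * (W' * U) = W' * ([:-1, 1:] ^ L * U)" by (rule mult.left_commute)
  also have "\<dots> = [:-1, 1:] ^ L * 1" using split[symmetric] unfolding U by (simp only: mult_1_right)
  finally have "[:-1, 1:] ^ L * (W' * U) = [:-1, 1:] ^ L * 1" .
  then have "W' * U = 1" by (subst (asm) mult_left_cancel) auto
  then have "W' dvd 1" by (rule dvdI[OF sym])
  moreover have "W' \<noteq> 0" using nz(1) W'(1) by auto
  ultimately have "degree W' = 0" using is_unit_iff_degree by blast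
  then have "degree W = o'" unfolding W'(1) using nz W'
    by (subst degree_mult_eq) (auto simp: degree_linear_power)
  then have n: "n \<le> o'" using degW by simp
  define r where "r = p - q"
  have degr: "degree r = n" unfolding r_def n_def using deg
    using degree_add_eq_right[of p "- q"] by simp
  then have rnz: "r \<noteq> 0" "pderiv r \<noteq> 0" using deg n_def by (auto simp: pderiv_eq_0_iff)
  have "[:-1, 1:] ^ order 1 r dvd W"
    using n order_degree[OF rnz(1), of 1] degr nz by (simp add: order_divides o'_def)
  moreover have "p * pderiv r = r * pderiv p - W"
    by (simp add: r_def W_def pderiv_diff algebra_simps)
  ultimately have "[:-1, 1:] ^ order 1 r dvd p * pderiv r"
    by (simp add: order_1 dvd_diff)
  moreover have "\<not> [:-1, 1:] dvd p" using p1 by (simp add: poly_eq_0_iff_dvd[symmetric])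
  ultimately have "[:-1, 1:] ^ order 1 r dvd pderiv r"
    using prime_elem_power_dvd_cases[of "[:-1, 1:]" "order 1 r" p "pderiv r" 1 "order 1 r"]
      prime_elem_root[of "1::'k"] by auto
  then have "order 1 r \<le> order 1 (pderiv r)" using rnz by (simp add: order_divides)
  moreover have "order 1 r = Suc (order 1 (pderiv r))"
    using rnz pq by (intro order_pderiv) (simp_all add: r_def)
  ultimately show False by simp
qed

text \<open>
  Forms of degree \<open>k\<close> in \<open>K[x,y]\<close>; the Wronskian is taken with respect to \<open>y\<close>, the outer variable.
  Both leading coefficients in \<open>y\<close> are monomials in \<open>x\<close>, so that a constant multiple of \<open>q\<close> can be
  subtracted from \<open>p\<close> to lower the degree in \<open>y\<close>, which is possible only if nothing remains.
\<close>

lemma forms_proportional: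
  fixes p q :: "'k::field_char_0 poly poly"
  assumes hp: "\<And>i j. i + j \<noteq> k \<Longrightarrow> coeff (coeff p j) i = 0"
    and hq: "\<And>i j. i + j \<noteq> k \<Longrightarrow> coeff (coeff q j) i = 0"
    and W: "p * pderiv q = q * pderiv p"
  obtains s t r where "p = [:[:s:]:] * r" "q = [:[:t:]:] * r"
    "\<And>i j. i + j \<noteq> k \<Longrightarrow> coeff (coeff r j) i = 0"
proof (cases "q = 0 \<or> p = 0")
  case True
  then show thesis
    using that[of 1 p 0] that[of 0 q 1] hp hq by (auto simp: one_pCons[symmetric])
next
  case False
  then have eq: "degree p = degree q" by (intro wronskian_zero_degree W) auto
  define j where "j = degree q"
  define s where "s = coeff (coeff p j) (k - j) / coeff (coeff q j) (k - j)"
  define r where "r = p - [:[:s:]:] * q"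
  have "coeff q j \<noteq> 0" using False by (simp add: j_def)
  then obtain i0 where "coeff (coeff q j) i0 \<noteq> 0" by (auto simp: poly_eq_iff)
  moreover from this have "i0 = k - j" using hq[of i0 j] by (cases "i0 + j = k") auto
  ultimately have nz: "coeff (coeff q j) (k - j) \<noteq> 0" by simp
  have "coeff (coeff r j) i = 0" for i
  proof (cases "i + j = k")
    case True
    then have "i = k - j" by simp
    then show ?thesis using nz by (simp add: r_def s_def)
  next
    case False
    then show ?thesis using hp hq by (simp add: r_def)
  qed
  then have rj: "coeff r j = 0" by (simp add: poly_eq_iff)
  have "pderiv ([:[:s:]:] * q) = [:[:s:]:] * pderiv q" by (simp add: pderiv_smult)
  then have "r * pderiv q = q * pderiv r"
    using W by (simp add: r_def pderiv_diff algebra_simps)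
  then have "r = 0"
    using wronskian_zero_degree[of r q] False rj unfolding j_def by (metis leading_coeff_0_iff)
  then show thesis using that[of s q 1] hq by (simp add: r_def one_pCons[symmetric])
qed

subsection \<open>Cancelling linear factors of a form in the plane\<close>

lemma prime_elem_plane:
  shows "prime_elem ([:[:0, 1:]:] :: 'k::field_char_0 poly poly)"
    and "prime_elem ([:[:0, 1:]:] - [:0, 1:] :: 'k::field_char_0 poly poly)"
proof -
  show "prime_elem ([:[:0, 1:]:] :: 'k poly poly)"
    using prime_elem_root[of "0 :: 'k"] by (simp add: lift_prime_elem_poly)
  show "prime_elem ([:[:0, 1:]:] - [:0, 1:] :: 'k poly poly)"
    using prime_elem_root[of "[:0, 1 :: 'k:]"]
      prime_elem_uminus[of "[:[:0, 1:]:] - [:0, 1:] :: 'k poly poly"] by simp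
qed

text \<open>
  As \<open>s\<close> and \<open>t\<close> are not both zero, at least two of the three divisibilities hold. Cancelling one
  copy of each linear factor concerned splits off a factor \<open>M\<close> of order at least two at the origin.
\<close>

lemma split_off_order_two:
  fixes r :: "'k::field_char_0 poly poly" and s t :: 'k
  defines "x \<equiv> [:[:0, 1:]:]" and "y \<equiv> [:0, 1:]"
  assumes nz: "s \<noteq> 0 \<or> t \<noteq> 0"
    and s: "s \<noteq> 0 \<Longrightarrow> x ^ Suc d dvd r"
    and t: "t \<noteq> 0 \<Longrightarrow> y ^ Suc b dvd r"
    and st: "s \<noteq> t \<Longrightarrow> (x - y) ^ Suc c dvd r"
  obtains M r' where "r = M * r'" "order_ge 2 M"
    "s \<noteq> 0 \<Longrightarrow> x ^ d dvd r'" "t \<noteq> 0 \<Longrightarrow> y ^ b dvd r'" "s \<noteq> t \<Longrightarrow> (x - y) ^ c dvd r'"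
proof -
  define i j k where "i = (if s \<noteq> 0 then Suc d else 0)" and "j = (if t \<noteq> 0 then Suc b else 0)"
    and "k = (if s \<noteq> t then Suc c else 0)"
  have nx: "\<not> x dvd y ^ j"
  proof
    assume "x dvd y ^ j"
    then obtain m where "y ^ j = x * m" by blast
    then have "poly (poly (y ^ j) 1) 0 = poly (poly (x * m) 1) 0" by (simp only:)
    then have "poly (poly (y ^ j) 1) 0 = 0" by (simp add: x_def)
    then show False by (simp add: y_def)
  qed
  have nxy: "\<not> x - y dvd x ^ i * y ^ j"
  proof
    assume "x - y dvd x ^ i * y ^ j"
    then obtain m where "x ^ i * y ^ j = (x - y) * m" by blast
    then have "poly (poly (x ^ i * y ^ j) 1) 1 = poly (poly ((x - y) * m) 1) 1" by (simp only:)
    then show False by (simp add: x_def y_def)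
  qed
  have prime: "prime_elem x" "prime_elem (x - y)"
    unfolding x_def y_def by (rule prime_elem_plane)+
  have "x ^ i dvd r" "y ^ j dvd r" "(x - y) ^ k dvd r"
    using s t st unfolding i_def j_def k_def by (simp_all del: power_Suc)
  then have "(x - y) ^ k * (x ^ i * y ^ j) dvd r"
    by (intro prime_power_mult_dvd[OF prime(2) nxy] prime_power_mult_dvd[OF prime(1) nx])
  then obtain r0 where r0: "r = (x - y) ^ k * (x ^ i * y ^ j) * r0" by blast
  define M where "M = (x - y) ^ (if s \<noteq> t then 1 else 0) *
    (x ^ (if s \<noteq> 0 then 1 else 0) * y ^ (if t \<noteq> 0 then 1 else 0))"
  define r' where "r' = (x - y) ^ (k - 1) * (x ^ (i - 1) * y ^ (j - 1)) * r0"
  have "r = M * r'" unfolding r0 M_def r'_def i_def j_def k_def by simp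
  moreover have "order_ge 2 M"
  proof -
    have o: "order_ge 1 x" "order_ge 1 y" "order_ge 1 (x - y)"
      unfolding x_def y_def by (rule order_ge_x order_ge_y order_ge_x_minus_y)+
    show ?thesis
      using nz order_ge_mult[OF o(1,2)] order_ge_mult[OF o(3,1)] order_ge_mult[OF o(3,2)]
        order_ge_mult[OF order_ge_zero[of "x - y"] order_ge_mult[OF o(1,2)]]
      by (auto simp: M_def numeral_2_eq_2)
  qed
  moreover have "s \<noteq> 0 \<Longrightarrow> x ^ d dvd r'" "t \<noteq> 0 \<Longrightarrow> y ^ b dvd r'" "s \<noteq> t \<Longrightarrow> (x - y) ^ c dvd r'"
    by (auto simp: r'_def i_def j_def k_def)
  ultimately show thesis by (rule that)
qed

section \<open>Truncated binomial expansions\<close>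

text \<open>
  The part of the binomial expansion of \<open>(u - v)\<^bsup>e+a+1\<^esup>\<close> in which \<open>u\<close> has an exponent
  greater than \<open>e\<close>; in the rest, \<open>v\<close> has an exponent greater than \<open>a\<close>.
\<close>

definition truncated_binomial :: "nat \<Rightarrow> nat \<Rightarrow> 'a::comm_ring_1 \<Rightarrow> 'a \<Rightarrow> 'a" where
  "truncated_binomial e a u v =
     (\<Sum>i=Suc e..Suc (e + a). of_nat (Suc (e + a) choose i) * u ^ i * (- v) ^ (Suc (e + a) - i))"

lemma power_dvd_truncated_binomial: "u ^ Suc e dvd truncated_binomial e a u v"
  unfolding truncated_binomial_def
  by (intro dvd_sum dvd_mult2 dvd_mult le_imp_power_dvd) simp

lemma power_dvd_truncated_binomial_minus:
  "v ^ Suc a dvd truncated_binomial e a u v - (u - v) ^ Suc (e + a)"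
proof -
  let ?F = "\<lambda>i. of_nat (Suc (e + a) choose i) * u ^ i * (- v) ^ (Suc (e + a) - i)"
  have "(u - v) ^ Suc (e + a) = (\<Sum>i\<le>Suc (e + a). ?F i)"
    using binomial_ring[of u "- v" "Suc (e + a)"] by simp
  also have "{..Suc (e + a)} = {..e} \<union> {Suc e..Suc (e + a)}" by auto
  also have "(\<Sum>i\<in>\<dots>. ?F i) = (\<Sum>i\<le>e. ?F i) + truncated_binomial e a u v"
    unfolding truncated_binomial_def by (rule sum.union_disjoint) auto
  finally have "truncated_binomial e a u v - (u - v) ^ Suc (e + a) = - (\<Sum>i\<le>e. ?F i)" by simp
  moreover have "v ^ Suc a dvd (- v) ^ (Suc (e + a) - i)" if "i \<le> e" for i
  proof -
    have "v ^ Suc a dvd (- v) ^ Suc a" by (subst power_minus) (rule dvd_triv_right)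
    also have "(- v) ^ Suc a dvd (- v) ^ (Suc (e + a) - i)"
      using that by (intro le_imp_power_dvd) simp
    finally show ?thesis .
  qed
  ultimately show ?thesis by (auto intro!: dvd_sum dvd_mult simp del: power_Suc)
qed

text \<open>
  A derivation that takes the same value on \<open>u\<close> and \<open>v\<close> kills \<open>u - v\<close>; on the truncated
  expansion it telescopes to a single monomial.
\<close>

lemma derivation_truncated_binomial:
  assumes D: "derivation D" and "D u = w" "D v = w"
  shows "D (truncated_binomial e a u v) =
    of_nat (Suc (e + a) * ((e + a) choose e)) * (- 1) ^ a * w * u ^ e * v ^ a"
proof -
  define N where "N = e + a"
  define b where "b i = of_nat (N choose i) * u ^ i * (- v) ^ (N - i)" for i
  have step: "D (of_nat (Suc N choose Suc i) * u ^ Suc i * (- v) ^ (Suc N - Suc i)) =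
      of_nat (Suc N) * w * (b i - b (Suc i))" if "i \<le> N" for i
  proof -
    have "D (of_nat (Suc N choose Suc i) * u ^ Suc i * (- v) ^ (N - i)) =
        of_nat (Suc N choose Suc i) * (of_nat (Suc i) * u ^ i * w * (- v) ^ (N - i)
          - u ^ Suc i * (of_nat (N - i) * (- v) ^ (N - Suc i) * w))"
      using derivation_power[OF D, of u "Suc i"] derivation_power[OF D, of "- v" "N - i"] assms(2,3)
      by (simp add: derivation_mult[OF D] derivation_of_nat[OF D] derivation_uminus[OF D]
          right_diff_distrib mult.assoc del: power_Suc of_nat_Suc binomial_Suc_Suc)
    also have "\<dots> = of_nat (Suc i * (Suc N choose Suc i)) * (u ^ i * w * (- v) ^ (N - i))
        - of_nat ((Suc N - Suc i) * (Suc N choose Suc i)) * (u ^ Suc i * w * (- v) ^ (N - Suc i))"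
      by (simp only: of_nat_mult diff_Suc_Suc right_diff_distrib ac_simps)
    also have "\<dots> = of_nat (Suc N * (N choose i)) * (u ^ i * w * (- v) ^ (N - i))
        - of_nat (Suc N * (N choose Suc i)) * (u ^ Suc i * w * (- v) ^ (N - Suc i))"
      unfolding Suc_times_binomial binomial_absorb_comp by simp
    also have "\<dots> = of_nat (Suc N) * w * (b i - b (Suc i))"
      by (simp only: b_def of_nat_mult right_diff_distrib ac_simps)
    finally show ?thesis by simp
  qed
  have "D (truncated_binomial e a u v) =
      (\<Sum>i=e..N. D (of_nat (Suc N choose Suc i) * u ^ Suc i * (- v) ^ (Suc N - Suc i)))"
    unfolding truncated_binomial_def N_def derivation_sum[OF D] sum.shift_bounds_cl_Suc_ivl ..
  also have "\<dots> = (\<Sum>i=e..N. of_nat (Suc N) * w * (b i - b (Suc i)))"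
    by (intro sum.cong refl step) simp
  also have "\<dots> = of_nat (Suc N) * w * (- (\<Sum>i=e..N. b (Suc i) - b i))"
    by (simp add: sum_distrib_left[symmetric] sum_negf[symmetric] del: of_nat_Suc)
  also have "\<dots> = of_nat (Suc N) * w * b e"
  proof -
    have "b (Suc N) = 0" by (simp add: b_def binomial_eq_0 del: binomial_Suc_Suc power_Suc)
    then show ?thesis by (subst sum_Suc_diff) (simp_all add: N_def)
  qed
  also have "\<dots> = of_nat (Suc N * (N choose e)) * (- 1) ^ a * w * u ^ e * v ^ a"
  proof -
    have "N - e = a" by (simp add: N_def)
    then show ?thesis by (simp only: b_def power_minus[of v] of_nat_mult ac_simps)
  qed
  finally show ?thesis by (simp only: N_def)
qed

lemma homogeneous_truncated_binomial:
  assumes "homogeneous_poly 1 u" "homogeneous_poly 1 v"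
  shows "homogeneous_poly (Suc (e + a)) (truncated_binomial e a u v)"
  unfolding truncated_binomial_def
proof (rule homogeneous_poly_sum)
  fix i assume "i \<in> {Suc e..Suc (e + a)}"
  then have "0 + 1 * i + 1 * (Suc (e + a) - i) = Suc (e + a)" by simp
  then show "homogeneous_poly (Suc (e + a))
      (of_nat (Suc (e + a) choose i) * u ^ i * (- v) ^ (Suc (e + a) - i))"
    using assms by (metis homogeneous_poly_mult homogeneous_poly_of_nat homogeneous_poly_power
        homogeneous_poly_uminus)
qed

lemma is_unit_telescoping_constant:
  "is_unit (of_nat (Suc (e + a) * ((e + a) choose e)) * (- 1) ^ a :: 'k::field_char_0 poly3)"
proof -
  have "is_unit (of_nat k :: 'k poly3)" if "k > 0" for k
    using that is_unit_of_nat_poly3[of "k - 1"] by simp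
  then show ?thesis by (auto simp: is_unit_power_iff simp del: mult_Suc of_nat_mult)
qed

section \<open>A universal derivation in the balanced case\<close>

text \<open>
  The membership \<open>p \<partial>\<^sub>x + q \<partial>\<^sub>y + r \<partial>\<^sub>z \<in> D(A, m)\<close> for the five standard forms, where \<open>m\<close> has
  the values \<open>a\<close>, \<open>b\<close>, \<open>c\<close>, \<open>d\<close>, \<open>e\<close> on the kernels of \<open>y - z\<close>, \<open>y\<close>, \<open>x - y\<close>, \<open>x\<close>, \<open>x - z\<close>.
\<close>

definition log_triple ::
  "nat \<Rightarrow> nat \<Rightarrow> nat \<Rightarrow> nat \<Rightarrow> nat \<Rightarrow> 'k::field_char_0 poly3 \<Rightarrow> 'k poly3 \<Rightarrow> 'k poly3 \<Rightarrow> bool" where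
  "log_triple a b c d e p q r \<longleftrightarrow>
     (Y - Z) ^ a dvd q - r \<and> Y ^ b dvd q \<and> (X - Y) ^ c dvd p - q \<and> X ^ d dvd p \<and>
     (X - Z) ^ e dvd p - r"

lemma der_apply_triple: "der_apply (u, v, w) p = u * dx p + v * dy p + w * dz p"
  by (simp add: der_apply_def)

lemma X_minus_Y_nonzero: "X - Y \<noteq> (0 :: 'k::field_char_0 poly3)"
  by (simp add: X_def Y_def)

lemma not_X_dvd_Y_power: "\<not> X dvd (Y :: 'k::field_char_0 poly3) ^ k"
  using on_line_dvd[of "X :: 'k poly3" "Y ^ k" 0 1] by auto

lemma not_X_minus_Z_dvd_Y_minus_Z_power: "\<not> X - Z dvd (Y - Z :: 'k::field_char_0 poly3) ^ k"
proof
  assume "X - Z dvd (Y - Z :: 'k poly3) ^ k"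
  then have "[:0, - 1:] dvd [:1, - 1 :: 'k:] ^ k"
    using on_line_dvd[of "X - Z :: 'k poly3" "(Y - Z) ^ k" 0 1] by simp
  then have "poly ([:1, - 1 :: 'k:] ^ k) 0 = 0" by (auto simp only: dvd_def poly_mult) simp
  then show False by simp
qed

text \<open>
  The last two properties of \<open>f\<close>, \<open>g\<close>, \<open>h\<close> say that the map \<open>\<chi> \<mapsto> \<nabla>\<^sub>\<chi> \<theta>\<close> is onto \<open>D(A, m)\<close> and has a trivial
  kernel.
\<close>

lemma balanced_universal:
  assumes c1: "c = a + e" and c2: "c = b + d"
  obtains f g h :: "'k::field_char_0 poly3"
  where "homogeneous_poly (Suc c) f" "homogeneous_poly (Suc c) g" "homogeneous_poly (Suc c) h"
    and "f \<noteq> g"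
    and "log_triple (Suc a) (Suc b) (Suc c) (Suc d) (Suc e) f g h"
    and "\<And>p q r. log_triple a b c d e p q r \<Longrightarrow>
      \<exists>\<chi>. der_apply \<chi> f = p \<and> der_apply \<chi> g = q \<and> der_apply \<chi> h = r"
    and "\<And>\<chi>. der_apply \<chi> f = 0 \<Longrightarrow> der_apply \<chi> g = 0 \<Longrightarrow> der_apply \<chi> h = 0 \<Longrightarrow> \<chi> = 0"
proof -
  define f :: "'k poly3" where "f = truncated_binomial d b X Y"
  define P :: "'k poly3" where "P = truncated_binomial e a (X - Z) (Y - Z)"
  define g where "g = f - (X - Y) ^ Suc c"
  define h where "h = f - P"
  have cd: "Suc (d + b) = Suc c" "Suc (e + a) = Suc c" using c1 c2 by simp_all
  have hom_f: "homogeneous_poly (Suc c) f"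
    unfolding f_def cd(1)[symmetric] by (intro homogeneous_truncated_binomial homogeneous_poly_XYZ)
  have hom_P: "homogeneous_poly (Suc c) P"
    unfolding P_def cd(2)[symmetric]
    by (intro homogeneous_truncated_binomial homogeneous_poly_diff homogeneous_poly_XYZ)
  have hom_g: "homogeneous_poly (Suc c) g"
    unfolding g_def
    using homogeneous_poly_power[OF homogeneous_poly_diff[OF homogeneous_poly_XYZ(1,2)], of "Suc c"]
    by (intro homogeneous_poly_diff hom_f) simp
  have hom_h: "homogeneous_poly (Suc c) h"
    unfolding h_def by (intro homogeneous_poly_diff hom_f hom_P)
  have fg: "f - g = (X - Y) ^ Suc c" by (simp add: g_def)
  have "f - g \<noteq> 0" unfolding fg using X_minus_Y_nonzero by (rule power_not_zero)
  then have "f \<noteq> g" by simp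
  have div_f: "X ^ Suc d dvd f" unfolding f_def by (rule power_dvd_truncated_binomial)
  have div_g: "Y ^ Suc b dvd g"
    using power_dvd_truncated_binomial_minus[of Y b d X] unfolding g_def f_def cd(1) .
  have div_fh: "(X - Z) ^ Suc e dvd f - h"
    unfolding h_def P_def by (simp add: power_dvd_truncated_binomial del: power_Suc)
  have gh: "g - h = P - (X - Y) ^ Suc c" by (simp add: g_def h_def)
  have div_gh: "(Y - Z) ^ Suc a dvd g - h"
    using power_dvd_truncated_binomial_minus[of "Y - Z" a e "X - Z"] unfolding gh P_def cd(2) by simp
  have log: "log_triple (Suc a) (Suc b) (Suc c) (Suc d) (Suc e) f g h"
    unfolding log_triple_def using div_f div_g div_fh div_gh fg by simp
  \<comment> \<open>The constants of the two monomials to which derivatives of \<open>f\<close> and \<open>P\<close> telescope.\<close>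
  define K1 :: "'k poly3" where "K1 = of_nat (Suc (d + b) * ((d + b) choose d)) * (- 1) ^ b"
  define K2 :: "'k poly3" where "K2 = of_nat (Suc (e + a) * ((e + a) choose e)) * (- 1) ^ a"
  have "is_unit K1" "is_unit K2"
    unfolding K1_def K2_def by (rule is_unit_telescoping_constant)+
  then obtain K1' K2' where K1': "K1 * K1' = 1" and K2': "K2 * K2' = 1"
    by (metis dvd_def)
  obtain n' :: "'k poly3" where n': "of_nat (Suc c) * n' = 1"
    using is_unit_of_nat_poly3[of c] by (metis dvd_def)
  have "der_apply (1, 1, 0) f = K1 * 1 * X ^ d * Y ^ b"
    unfolding f_def K1_def
    by (rule derivation_truncated_binomial[OF derivation_der_apply]) (simp_all add: der_apply_def)
  then have f_xy: "dx f + dy f = K1 * X ^ d * Y ^ b" by (simp add: der_apply_def)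
  have f_z: "dz f = 0"
    unfolding f_def by (subst derivation_truncated_binomial[OF derivation_dz, where w = 0]) simp_all
  have fg_x: "dx f - dx g = of_nat (Suc c) * (X - Y) ^ c"
    and fg_y: "dy f - dy g = - (of_nat (Suc c) * (X - Y) ^ c)"
    and "dz f - dz g = 0"
    unfolding derivation_diff[OF derivation_dx, symmetric] derivation_diff[OF derivation_dy, symmetric]
      derivation_diff[OF derivation_dz, symmetric] fg derivation_power[OF derivation_dx]
      derivation_power[OF derivation_dy] derivation_power[OF derivation_dz]
    by (simp_all add: derivation_diff[OF derivation_dx] derivation_diff[OF derivation_dy]
        derivation_diff[OF derivation_dz])
  then have g_z: "dz g = 0" using f_z by simp
  have "dz P = K2 * (- 1) * (X - Z) ^ e * (Y - Z) ^ a"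
    unfolding P_def K2_def
    by (rule derivation_truncated_binomial[OF derivation_dz])
      (simp_all add: derivation_diff[OF derivation_dz])
  then have h_z: "dz h = K2 * (X - Z) ^ e * (Y - Z) ^ a"
    by (simp add: h_def derivation_diff[OF derivation_dz] f_z)
  show thesis
  proof (rule that[OF hom_f hom_g hom_h \<open>f \<noteq> g\<close> log])
    fix p q r :: "'k poly3" assume "log_triple a b c d e p q r"
    then have pqr: "(Y - Z) ^ a dvd q - r" "Y ^ b dvd q" "(X - Y) ^ c dvd p - q" "X ^ d dvd p"
      "(X - Z) ^ e dvd p - r" by (auto simp: log_triple_def)
    \<comment> \<open>For \<open>\<chi> = (u, v, w)\<close> the system is triangular in the unknowns \<open>u - v = s\<close>, \<open>v\<close>, \<open>w\<close>.\<close>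
    obtain s0 where s0: "p - q = (X - Y) ^ c * s0" using pqr(3) by blast
    define s where "s = n' * s0"
    have s: "of_nat (Suc c) * (X - Y) ^ c * s = p - q"
    proof -
      have "of_nat (Suc c) * (X - Y) ^ c * s = (of_nat (Suc c) * n') * ((X - Y) ^ c * s0)"
        unfolding s_def by (simp only: ac_simps)
      then show ?thesis unfolding n' s0 by simp
    qed
    have "X ^ d dvd p - dx f * s"
      using power_dvd_derivation[OF derivation_dx div_f] pqr(4) by (intro dvd_diff dvd_mult2)
    moreover have "p - dx f * s - (q - dx g * s) = p - q - (dx f - dx g) * s"
      by (simp add: algebra_simps)
    then have "p - dx f * s = q - dx g * s" unfolding fg_x s by simp
    then have "Y ^ b dvd p - dx f * s"
      using power_dvd_derivation[OF derivation_dx div_g] pqr(2)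
      by (simp add: dvd_diff)
    ultimately have "X ^ d * Y ^ b dvd p - dx f * s"
      by (intro prime_power_mult_dvd prime_elem_X not_X_dvd_Y_power)
    then obtain t where t: "p - dx f * s = X ^ d * Y ^ b * t" by blast
    define v where "v = K1' * t"
    define u where "u = v + s"
    have f_uv: "u * dx f + v * dy f = p"
    proof -
      have "u * dx f + v * dy f = v * (dx f + dy f) + dx f * s"
        by (simp add: u_def algebra_simps)
      also have "v * (dx f + dy f) = (K1 * K1') * (X ^ d * Y ^ b * t)"
        unfolding f_xy v_def by (simp only: ac_simps)
      finally show ?thesis unfolding K1' t[symmetric] by simp
    qed
    have g_uv: "u * dx g + v * dy g = q"
    proof -
      have "u * (dx f - dx g) + v * (dy f - dy g) = p - q"
        unfolding fg_x fg_y s[symmetric] u_def by (simp add: algebra_simps)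
      then have "u * dx f + v * dy f - (u * dx g + v * dy g) = p - q" by (simp add: algebra_simps)
      then have "p - (u * dx g + v * dy g) = p - q" unfolding f_uv .
      from arg_cong[OF this, of "\<lambda>t. p - t"] show ?thesis
        by (simp only: diff_diff_eq2 add_diff_cancel_left')
    qed
    have eq1: "r - (u * dx h + v * dy h) = u * dx (f - h) + v * dy (f - h) - (p - r)"
      unfolding derivation_diff[OF derivation_dx] derivation_diff[OF derivation_dy] f_uv[symmetric]
      by (simp add: algebra_simps)
    have 1: "(X - Z) ^ e dvd r - (u * dx h + v * dy h)"
      unfolding eq1
      by (intro dvd_diff dvd_add dvd_mult pqr(5) power_dvd_derivation[OF derivation_dx div_fh]
          power_dvd_derivation[OF derivation_dy div_fh])
    have eq2: "r - (u * dx h + v * dy h) = u * dx (g - h) + v * dy (g - h) - (q - r)"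
      unfolding derivation_diff[OF derivation_dx] derivation_diff[OF derivation_dy] g_uv[symmetric]
      by (simp add: algebra_simps)
    have 2: "(Y - Z) ^ a dvd r - (u * dx h + v * dy h)"
      unfolding eq2
      by (intro dvd_diff dvd_add dvd_mult pqr(1) power_dvd_derivation[OF derivation_dx div_gh]
          power_dvd_derivation[OF derivation_dy div_gh])
    have "(X - Z) ^ e * (Y - Z) ^ a dvd r - (u * dx h + v * dy h)"
      by (intro prime_power_mult_dvd prime_elem_X_minus_Z not_X_minus_Z_dvd_Y_minus_Z_power 1 2)
    then obtain w0 where w0: "r - (u * dx h + v * dy h) = (X - Z) ^ e * (Y - Z) ^ a * w0" by blast
    have "K2' * w0 * dz h = (K2 * K2') * ((X - Z) ^ e * (Y - Z) ^ a * w0)"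
      unfolding h_z by (simp only: ac_simps)
    then have "u * dx h + v * dy h + K2' * w0 * dz h = r" unfolding K2' w0[symmetric] by simp
    then show "\<exists>\<chi>. der_apply \<chi> f = p \<and> der_apply \<chi> g = q \<and> der_apply \<chi> h = r"
      using f_uv g_uv f_z g_z by (intro exI[of _ "(u, v, K2' * w0)"]) (simp add: der_apply_def)
  next
    fix \<chi> :: "'k der"
    assume 0: "der_apply \<chi> f = 0" "der_apply \<chi> g = 0" "der_apply \<chi> h = 0"
    obtain u v w where \<chi>: "\<chi> = (u, v, w)" by (cases \<chi>)
    have nz: "K1 \<noteq> 0" "K2 \<noteq> 0" "(of_nat (Suc c) :: 'k poly3) \<noteq> 0"
      using K1' K2' n' by (auto simp del: of_nat_Suc)
    have zero: "u * dx f + v * dy f = 0" "u * dx g + v * dy g = 0"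
      using 0(1,2) f_z g_z by (simp_all add: \<chi> der_apply_def)
    have "u * (dx f - dx g) + v * (dy f - dy g) =
        (u * dx f + v * dy f) - (u * dx g + v * dy g)" by (simp add: algebra_simps)
    then have "of_nat (Suc c) * (X - Y) ^ c * (u - v) = 0"
      unfolding fg_x fg_y zero by (simp add: algebra_simps del: of_nat_Suc)
    then have uv: "u = v" using nz(3) power_not_zero[OF X_minus_Y_nonzero, of c]
      by (simp only: mult_eq_0_iff right_minus_eq) blast
    have "v * (dx f + dy f) = 0"
      using zero(1) by (simp add: uv distrib_left)
    then have v: "v = 0" unfolding f_xy using nz by (simp add: X_def Y_def)
    have "w * dz h = 0" using 0(3) by (simp add: \<chi> uv v der_apply_def)
    then have "w = 0" unfolding h_z using nz by (simp add: X_def Y_def Z_def)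
    then show "\<chi> = 0" by (simp add: \<chi> uv v zero_prod_def)
  qed
qed

section \<open>Multiplicities that admit a universal derivation\<close>

subsection \<open>Degrees in \<open>z\<close> and determinants\<close>

lemma X_minus_Y_eq: "X - Y = [:[:[:0, 1:]:] - [:0, 1:]:]"
  by (simp add: X_def Y_def)

lemma coeff_X_minus_Y_power_mult:
  "coeff ((X - Y) ^ k * p) l = ([:[:0, 1:]:] - [:0, 1:]) ^ k * coeff p l"
  unfolding X_minus_Y_eq poly_const_pow by simp

lemma X_power_eq: "X ^ k = [:[:[:0, 1:]:] ^ k:]"
  unfolding X_def poly_const_pow ..

lemma Y_power_eq: "Y ^ k = [:[:0, 1:] ^ k:]"
  unfolding Y_def poly_const_pow ..

lemma X_minus_Y_power_eq: "(X - Y) ^ k = [:([:[:0, 1:]:] - [:0, 1:]) ^ k:]"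
  unfolding X_minus_Y_eq poly_const_pow ..

lemma degree_X_minus_Y_power_mult: "degree ((X - Y :: 'k::field_char_0 poly3) ^ k * p) = degree p"
proof -
  have "([:[:0, 1:]:] - [:0, 1:] :: 'k poly poly) ^ k \<noteq> 0" by (rule power_not_zero) simp
  then show ?thesis unfolding X_minus_Y_eq poly_const_pow by simp
qed

lemma degree_dx_le: "degree p \<le> N \<Longrightarrow> degree (dx p) \<le> N"
  by (rule degree_le) (simp add: coeff_dx coeff_eq_0)

lemma degree_dy_le: "degree p \<le> N \<Longrightarrow> degree (dy p) \<le> N"
  by (rule degree_le) (simp add: coeff_dy coeff_eq_0)

lemma degree_dz_le: "degree p \<le> N \<Longrightarrow> degree (dz p) \<le> N - 1"
  by (rule degree_le) (auto simp: coeff_dz coeff_eq_0)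

lemma degree_mult_bound: "degree p \<le> m \<Longrightarrow> degree q \<le> k \<Longrightarrow> degree (p * q) \<le> m + k"
  by (rule order_trans[OF degree_mult_le]) simp

lemma coeff_mult_top3:
  assumes "degree p \<le> k" "degree q \<le> m" "degree r \<le> n"
  shows "coeff (p * (q * r)) (k + (m + n)) = coeff p k * (coeff q m * coeff r n)"
  using assms by (simp only: coeff_mult_top degree_mult_bound)

text \<open>
  If \<open>p\<close> has degree at most \<open>N\<close> in \<open>z\<close>, its monomials have degree at least \<open>n - N\<close> in \<open>x\<close> and \<open>y\<close>, and
  a derivation lowers the latter by at most one.
\<close>

lemma order_ge_coeff_derivative:
  assumes "homogeneous_poly n p" "degree p \<le> N" "N < n"
  shows "order_ge (n - N - 1) (coeff (der_apply \<chi> p) l)"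
proof -
  have "order_ge (n - N - 1) (coeff (dx p) l)" "order_ge (n - N - 1) (coeff (dy p) l)"
    "order_ge (n - N - 1) (coeff (dz p) l)" for l
  proof -
    have z: "coeff (coeff (coeff p l) j) i = 0" if "i + j < n - N" for i j l
    proof (cases "l \<le> N")
      case True
      then show ?thesis using that assms(3) by (intro homogeneous_polyD[OF assms(1)]) linarith
    next
      case False
      then show ?thesis using assms(2) by (simp add: coeff_eq_0)
    qed
    then show "order_ge (n - N - 1) (coeff (dx p) l)" "order_ge (n - N - 1) (coeff (dy p) l)"
      "order_ge (n - N - 1) (coeff (dz p) l)"
      by (simp_all add: order_ge_def coeff_dx coeff_dy coeff_dz coeff_map_poly coeff_pderiv
          coeff_of_nat_mult del: of_nat_Suc)
  qed
  then have "order_ge (n - N - 1) (coeff (u * dx p) l)" "order_ge (n - N - 1) (coeff (u * dy p) l)"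
    "order_ge (n - N - 1) (coeff (u * dz p) l)" for u
    unfolding coeff_mult
    by (auto intro!: order_ge_sum order_ge_mult_left)
  then show ?thesis by (cases \<chi>) (auto simp: der_apply_def intro!: order_ge_add)
qed

lemma dz_zero_dvd_imp_zero:
  assumes "dz p = 0" "L dvd p" "degree L > 0"
  shows "p = 0"
proof (rule ccontr)
  assume "p \<noteq> 0"
  obtain q where q: "p = L * q" using assms(2) by blast
  then have "degree p = degree L + degree q" using \<open>p \<noteq> 0\<close> by (auto intro: degree_mult_eq)
  moreover have "degree p = 0" using assms(1) by (simp add: dz_def pderiv_eq_0_iff)
  ultimately show False using assms(3) by simp
qed

text \<open>The determinant of the matrix with rows \<open>(x1, x2, x3)\<close>, \<open>(y1, y2, y3)\<close>, \<open>(z1, z2, z3)\<close>.\<close>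

definition det3 :: "'a::comm_ring_1 \<Rightarrow> 'a \<Rightarrow> 'a \<Rightarrow> 'a \<Rightarrow> 'a \<Rightarrow> 'a \<Rightarrow> 'a \<Rightarrow> 'a \<Rightarrow> 'a \<Rightarrow> 'a" where
  "det3 x1 x2 x3 y1 y2 y3 z1 z2 z3 =
     x1 * (y2 * z3 - y3 * z2) - x2 * (y1 * z3 - y3 * z1) + x3 * (y1 * z2 - y2 * z1)"

lemma det3_mult:
  "det3 u1 u2 u3 v1 v2 v3 w1 w2 w3 * det3 x1 x2 x3 y1 y2 y3 z1 z2 z3 =
   det3 (u1 * x1 + u2 * x2 + u3 * x3) (u1 * y1 + u2 * y2 + u3 * y3) (u1 * z1 + u2 * z2 + u3 * z3)
        (v1 * x1 + v2 * x2 + v3 * x3) (v1 * y1 + v2 * y2 + v3 * y3) (v1 * z1 + v2 * z2 + v3 * z3)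
        (w1 * x1 + w2 * x2 + w3 * x3) (w1 * y1 + w2 * y2 + w3 * y3) (w1 * z1 + w2 * z2 + w3 * z3)"
  unfolding det3_def by (simp add: algebra_simps)

lemma det3_scale:
  "det3 x1 x2 x3 (k * y1) (k * y2) (k * y3) z1 z2 z3 = k * det3 x1 x2 x3 y1 y2 y3 z1 z2 z3"
  unfolding det3_def by (simp add: algebra_simps)

subsection \<open>The forms \<open>f\<close>, \<open>g\<close>, \<open>h\<close>\<close>

text \<open>
  A homogeneous element \<open>\<theta> = f \<partial>\<^sub>x + g \<partial>\<^sub>y + h \<partial>\<^sub>z\<close> of \<open>D(A, m + 1)\<close> for which \<open>\<chi> \<mapsto> \<nabla>\<^sub>\<chi> \<theta>\<close> is onto
  \<open>D(A, m)\<close>; here \<open>a\<close>, \<open>b\<close>, \<open>c\<close>, \<open>d\<close>, \<open>e\<close> are the values of \<open>m\<close>.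
\<close>

locale universal_triple =
  fixes a b c d e n :: nat and f g h :: "'k::field_char_0 poly3"
  assumes hom_f: "homogeneous_poly n f" and hom_g: "homogeneous_poly n g"
    and hom_h: "homogeneous_poly n h"
    and log: "log_triple (Suc a) (Suc b) (Suc c) (Suc d) (Suc e) f g h"
    and surj: "\<And>p q r. log_triple a b c d e p q r \<Longrightarrow>
      \<exists>\<chi>. der_apply \<chi> f = p \<and> der_apply \<chi> g = q \<and> der_apply \<chi> h = r"
begin

lemma div_f: "X ^ Suc d dvd f" and div_g: "Y ^ Suc b dvd g"
  and div_fg: "(X - Y) ^ Suc c dvd f - g" and div_fh: "(X - Z) ^ Suc e dvd f - h"
  and div_gh: "(Y - Z) ^ Suc a dvd g - h"
  using log by (simp_all add: log_triple_def del: power_Suc)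

text \<open>
  The triples \<open>(F, F, F)\<close>, \<open>(0, 0, G)\<close>, \<open>(W, 0, 0)\<close> belong to \<open>D(A, m)\<close>. The factor \<open>(x - y)\<^bsup>c\<^esup>\<close> occurs in
  only one of them, and this is what allows cancelling it completely from the Jacobian determinant.
\<close>

definition F :: "'k poly3" where "F = X ^ d * Y ^ b"
definition G :: "'k poly3" where "G = (X - Z) ^ e * (Y - Z) ^ a"
definition W :: "'k poly3" where "W = (X - Y) ^ c * (X ^ d * (X - Z) ^ e)"

lemma on_line_G: "on_line 0 0 G = [:0, - 1:] ^ (e + a)"
  by (simp add: G_def power_add)

lemma forms_nonzero [simp]:
  "X \<noteq> (0 :: 'k poly3)" "Y \<noteq> (0 :: 'k poly3)" "X - Y \<noteq> (0 :: 'k poly3)"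
  "X - Z \<noteq> (0 :: 'k poly3)" "Y - Z \<noteq> (0 :: 'k poly3)"
  by (simp_all add: X_def Y_def Z_def)

lemma W_nonzero: "W \<noteq> 0"
  unfolding W_def by (intro no_zero_divisors power_not_zero forms_nonzero)

lemma obtain_F:
  obtains \<phi> where "der_apply \<phi> f = F" "der_apply \<phi> g = F" "der_apply \<phi> h = F"
  using surj[of F F F] by (auto simp: log_triple_def F_def)

lemma obtain_G:
  obtains \<psi> where "der_apply \<psi> f = 0" "der_apply \<psi> g = 0" "der_apply \<psi> h = G"
  using surj[of 0 0 G] by (auto simp: log_triple_def G_def)

lemma obtain_W:
  obtains \<omega> where "der_apply \<omega> f = W" "der_apply \<omega> g = 0" "der_apply \<omega> h = 0"
  using surj[of W 0 0] by (auto simp: log_triple_def W_def)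

lemma nonzero_f: "f \<noteq> 0" and f_neq_h: "f \<noteq> h" and f_neq_g: "f \<noteq> g"
  using obtain_W W_nonzero derivation_0[OF derivation_der_apply] by metis+

lemma nonzero_g: "g \<noteq> 0" and g_neq_h: "g \<noteq> h"
proof -
  define V :: "'k poly3" where "V = (X - Y) ^ c * (Y ^ b * (Y - Z) ^ a)"
  have "V \<noteq> 0" unfolding V_def by (intro no_zero_divisors power_not_zero forms_nonzero)
  moreover have "log_triple a b c d e 0 V 0" by (simp add: log_triple_def V_def)
  then obtain \<chi> where "der_apply \<chi> g = V" "der_apply \<chi> h = 0" using surj by blast
  ultimately show "g \<noteq> 0" "g \<noteq> h"
    using derivation_0[OF derivation_der_apply] by metis+
qed

lemma coeff_h: "coeff h n = [:[:coeff (coeff (coeff h n) 0) 0:]:]"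
  by (intro poly_eqI) (auto simp: coeff_pCons homogeneous_polyD[OF hom_h] split: nat.splits)

text \<open>
  A derivation that kills \<open>f\<close> and \<open>g\<close> is parallel to the line \<open>x = y = 0\<close> along that line. As one
  such derivation maps \<open>h\<close> to \<open>G\<close>, the form \<open>h\<close> does not vanish on the line, that is, \<open>z\<^sup>n\<close> occurs in \<open>h\<close>.
\<close>

lemma h_top_nonzero: "coeff (coeff (coeff h n) 0) 0 \<noteq> 0" and n_pos: "n > 0"
proof -
  obtain \<psi> where \<psi>: "der_apply \<psi> f = 0" "der_apply \<psi> g = 0" "der_apply \<psi> h = G"
    by (rule obtain_G)
  obtain u v w where uvw: "\<psi> = (u, v, w)" by (cases \<psi>)
  have "X dvd der_apply \<psi> X"
    using div_f by (intro prime_form_dvd_derivation[OF derivation_der_apply \<psi>(1) nonzero_f]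
        prime_elem_X lex_degree_forms) (auto dest: dvd_mult_left)
  moreover have "Y dvd der_apply \<psi> Y"
    using div_g by (intro prime_form_dvd_derivation[OF derivation_der_apply \<psi>(2) nonzero_g]
        prime_elem_Y lex_degree_forms) (auto dest: dvd_mult_left)
  ultimately have "on_line 0 0 u = 0" "on_line 0 0 v = 0"
    using on_line_dvd[of X u 0 0] on_line_dvd[of Y v 0 0] by (simp_all add: uvw der_apply_def)
  then have "on_line 0 0 w * pderiv (on_line 0 0 h) = on_line 0 0 G"
    unfolding \<psi>(3)[symmetric] by (simp add: uvw der_apply_def on_line_dz)
  then have "pderiv (on_line 0 0 h) \<noteq> 0" unfolding on_line_G by auto
  then obtain l where "coeff (pderiv (on_line 0 0 h)) l \<noteq> 0" by (auto simp: poly_eq_iff)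
  then have nz: "coeff (coeff (coeff h (Suc l)) 0) 0 \<noteq> 0"
    by (auto simp: coeff_pderiv coeff_on_line poly_0_coeff_0)
  then have "Suc l = n" using homogeneous_polyD[OF hom_h, of 0 0 "Suc l"] by auto
  then show "coeff (coeff (coeff h n) 0) 0 \<noteq> 0" "n > 0" using nz by auto
qed

text \<open>The analogous statement for the line \<open>x = y = z\<close> and the form \<open>f\<close>.\<close>

lemma f_nonzero_on_diagonal: "poly (on_line 1 1 f) 1 \<noteq> 0"
proof
  assume f0: "poly (on_line 1 1 f) 1 = 0"
  define E where "E q = poly (on_line 1 1 q) 1" for q :: "'k poly3"
  have E [simp]: "E (p + q) = E p + E q" "E (p * q) = E p * E q" "E (p - q) = E p - E q"
    "E X = 1" "E Y = 1" "E Z = 1" "E (p ^ k) = E p ^ k" for p q k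
    by (simp_all add: E_def)
  have E_dvd: "E p = 0 \<Longrightarrow> p dvd q \<Longrightarrow> E q = 0" for p q by (auto elim!: dvdE)
  obtain \<phi> where \<phi>: "der_apply \<phi> f = F" "der_apply \<phi> g = F" "der_apply \<phi> h = F"
    by (rule obtain_F)
  obtain u v w where uvw: "\<phi> = (u, v, w)" by (cases \<phi>)
  have "X - Z dvd der_apply \<phi> (X - Z)"
    using div_fh f_neq_h \<phi>
    by (intro prime_form_dvd_derivation[OF derivation_der_apply, where f = "f - h"]
        prime_elem_X_minus_Z lex_degree_forms)
      (auto dest: dvd_mult_left simp: derivation_diff[OF derivation_der_apply])
  moreover have "Y - Z dvd der_apply \<phi> (Y - Z)"
    using div_gh g_neq_h \<phi>
    by (intro prime_form_dvd_derivation[OF derivation_der_apply, where f = "g - h"]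
        prime_elem_Y_minus_Z lex_degree_forms)
      (auto dest: dvd_mult_left simp: derivation_diff[OF derivation_der_apply])
  ultimately have "E (der_apply \<phi> (X - Z)) = 0" "E (der_apply \<phi> (Y - Z)) = 0"
    by (auto intro: E_dvd[rotated])
  then have uvw_E: "E u = E w" "E v = E w"
    by (simp_all add: uvw derivation_diff[OF derivation_der_apply]) (simp_all add: der_apply_def)
  have "E (der_apply \<phi> f) = E w * E (X * dx f + Y * dy f + Z * dz f)"
    using uvw_E by (simp add: uvw der_apply_def algebra_simps)
  also have "\<dots> = 0" unfolding homogeneous_euler[OF hom_f] using f0 by (simp add: E_def)
  finally show False unfolding \<phi> by (simp add: F_def)
qed

subsection \<open>The Jacobian determinant\<close>

text \<open>
  The quotient of \<open>f - g\<close> by \<open>(x - y)\<^bsup>c+1\<^esup>\<close>, and the quotients of the partial derivatives of \<open>f - g\<close>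
  by \<open>(x - y)\<^bsup>c\<^esup>\<close>.
\<close>

definition T :: "'k poly3" where "T = (SOME T. f - g = (X - Y) ^ Suc c * T)"

lemma f_minus_g: "f - g = (X - Y) ^ Suc c * T"
  unfolding T_def by (rule someI_ex) (use div_fg in blast)

definition Tx :: "'k poly3" where "Tx = of_nat (Suc c) * T + (X - Y) * dx T"
definition Ty :: "'k poly3" where "Ty = - (of_nat (Suc c) * T) + (X - Y) * dy T"
definition Tz :: "'k poly3" where "Tz = (X - Y) * dz T"

lemma d_f_minus_g:
  "dx (f - g) = (X - Y) ^ c * Tx" "dy (f - g) = (X - Y) ^ c * Ty" "dz (f - g) = (X - Y) ^ c * Tz"
  unfolding f_minus_g derivation_power_mult[OF derivation_dx] derivation_power_mult[OF derivation_dy]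
    derivation_power_mult[OF derivation_dz]
  by (simp_all add: Tx_def Ty_def Tz_def derivation_diff[OF derivation_dx]
      derivation_diff[OF derivation_dy] derivation_diff[OF derivation_dz] del: of_nat_Suc)

text \<open>The Jacobian determinant of \<open>f\<close>, \<open>f - g\<close>, \<open>h\<close>, divided by \<open>(x - y)\<^bsup>c\<^esup>\<close>.\<close>

definition J :: "'k poly3" where
  "J = det3 (dx f) (dy f) (dz f) Tx Ty Tz (dx h) (dy h) (dz h)"

lemma J_multiple:
  obtains D where "D * J = - (F * G * (X ^ d * (X - Z) ^ e))"
proof -
  obtain \<phi> where \<phi>: "der_apply \<phi> f = F" "der_apply \<phi> g = F" "der_apply \<phi> h = F" by (rule obtain_F)
  obtain \<psi> where \<psi>: "der_apply \<psi> f = 0" "der_apply \<psi> g = 0" "der_apply \<psi> h = G" by (rule obtain_G)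
  obtain \<omega> where \<omega>: "der_apply \<omega> f = W" "der_apply \<omega> g = 0" "der_apply \<omega> h = 0" by (rule obtain_W)
  obtain u1 u2 u3 v1 v2 v3 w1 w2 w3
    where eq: "\<phi> = (u1, u2, u3)" "\<psi> = (v1, v2, v3)" "\<omega> = (w1, w2, w3)"
    by (metis prod_cases3)
  define D where "D = det3 u1 u2 u3 v1 v2 v3 w1 w2 w3"
  have "der_apply \<phi> (f - g) = 0" "der_apply \<psi> (f - g) = 0" "der_apply \<omega> (f - g) = W"
    by (simp_all add: derivation_diff[OF derivation_der_apply] \<phi> \<psi> \<omega>)
  then have "D * det3 (dx f) (dy f) (dz f) (dx (f - g)) (dy (f - g)) (dz (f - g)) (dx h) (dy h) (dz h)
      = det3 F 0 F 0 0 G W W 0"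
    using \<phi> \<psi> \<omega> unfolding D_def det3_mult eq der_apply_triple by (simp only:)
  then have "D * ((X - Y) ^ c * J) = - (F * G * W)"
    unfolding d_f_minus_g det3_scale J_def[symmetric] by (simp add: det3_def)
  then have "(X - Y) ^ c * (D * J) = (X - Y) ^ c * - (F * G * (X ^ d * (X - Z) ^ e))"
    unfolding W_def by (simp add: mult_ac)
  then have "D * J = - (F * G * (X ^ d * (X - Z) ^ e))"
    using power_not_zero[OF forms_nonzero(3), of c] mult_left_cancel by blast
  then show thesis by (rule that)
qed

lemma J_nonzero: "J \<noteq> 0"
proof
  assume "J = 0"
  moreover obtain D where "D * J = - (F * G * (X ^ d * (X - Z) ^ e))" by (rule J_multiple)
  moreover have "F * G * (X ^ d * (X - Z) ^ e) \<noteq> 0"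
    unfolding F_def G_def by (intro no_zero_divisors power_not_zero forms_nonzero)
  ultimately show False by simp
qed

subsection \<open>Restriction to the line \<open>x = y = 1\<close>\<close>

lemma coeff_f_top: "coeff f n = 0" and coeff_g_top: "coeff g n = 0"
proof -
  obtain f' g' where fg': "f = X * f'" "g = Y * g'"
    using div_f div_g by (metis dvdE dvd_mult_left power_Suc)
  have "coeff (coeff (coeff f n) j) i = 0" for i j
  proof (cases "i = 0 \<and> j = 0")
    case True
    then show ?thesis by (simp add: fg' coeff_X_mult)
  next
    case False
    then show ?thesis using homogeneous_polyD[OF hom_f] by simp
  qed
  then show "coeff f n = 0" by (simp add: poly_eq_iff)
  have "coeff (coeff (coeff g n) j) i = 0" for i j
  proof (cases "i = 0 \<and> j = 0")
    case True
    then show ?thesis by (simp add: fg' coeff_Y_mult)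
  next
    case False
    then show ?thesis using homogeneous_polyD[OF hom_g] by simp
  qed
  then show "coeff g n = 0" by (simp add: poly_eq_iff)
qed

text \<open>
  By the identity of Euler, \<open>\<partial>\<^sub>x + \<partial>\<^sub>y\<close> is expressed by the derivative along the line; the terms with
  two derivatives by \<open>z\<close> cancel and a Wronskian remains.
\<close>

lemma on_line_J:
  "on_line 1 1 J = - (of_nat (Suc c) * of_nat n * on_line 1 1 T *
     (on_line 1 1 f * pderiv (on_line 1 1 h) - on_line 1 1 h * pderiv (on_line 1 1 f)))"
proof -
  let ?r = "on_line (1 :: 'k) 1"
  have euler: "?r (dx q) + ?r (dy q) = of_nat n * ?r q - [:0, 1:] * pderiv (?r q)"
    if "homogeneous_poly n q" for q
    using arg_cong[OF homogeneous_euler[OF that], of ?r]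
    by (simp add: on_line_dz one_pCons[symmetric] eq_diff_eq)
  have T: "?r Tx = of_nat (Suc c) * ?r T" "?r Ty = - (of_nat (Suc c) * ?r T)" "?r Tz = 0"
    by (simp_all add: Tx_def Ty_def Tz_def)
  have "?r J = of_nat (Suc c) * ?r T * (pderiv (?r f) * (?r (dx h) + ?r (dy h))
      - (?r (dx f) + ?r (dy f)) * pderiv (?r h))"
    by (simp add: J_def det3_def T on_line_dz algebra_simps del: of_nat_Suc)
  then show ?thesis unfolding euler[OF hom_f] euler[OF hom_h]
    by (simp add: algebra_simps del: of_nat_Suc)
qed

lemma T_nonzero_on_line: "on_line 1 1 T \<noteq> 0"
  and f_const_on_line: "degree (on_line 1 1 f) = 0"
proof -
  let ?r = "on_line (1 :: 'k) 1"
  define w where "w = ?r f * pderiv (?r h) - ?r h * pderiv (?r f)"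
  obtain D where D: "D * J = - (F * G * (X ^ d * (X - Z) ^ e))" by (rule J_multiple)
  have "?r (F * G * (X ^ d * (X - Z) ^ e)) = [:1, - 1:] ^ (e + a + e)"
  proof -
    have "?r X = 1" "?r Y = 1" "?r (X - Z) = [:1, - 1:]" "?r (Y - Z) = [:1, - 1:]"
      by (simp_all add: one_pCons)
    then show ?thesis
      by (simp add: F_def G_def power_add mult_ac del: on_line_diff on_line_XYZ)
  qed
  then have eq: "?r D * (of_nat (Suc c) * of_nat n * ?r T * w) = [:1, - 1:] ^ (e + a + e)"
    using arg_cong[OF D, of ?r] by (simp add: on_line_J w_def del: of_nat_Suc)
  then show "?r T \<noteq> 0" by auto
  have "w dvd [:1, - 1:] ^ (e + a + e)" unfolding eq[symmetric] by simp
  also have "[:1, - 1 :: 'k:] = - [:- 1, 1:]" by simp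
  also have "\<dots> ^ (e + a + e) dvd [:- 1, 1:] ^ (e + a + e)"
    by (intro dvd_power_same) (simp only: minus_dvd_iff dvd_refl)
  finally have w: "w dvd [:- 1, 1:] ^ (e + a + e)" .
  have "coeff (?r h) n \<noteq> 0" by (subst coeff_on_line, subst coeff_h) (simp add: h_top_nonzero)
  then have deg_h: "degree (?r h) \<ge> n" by (rule le_degree)
  have "coeff (?r f) l = 0" if "l \<ge> n" for l
  proof (cases "l = n")
    case True
    then show ?thesis by (simp add: coeff_on_line coeff_f_top)
  next
    case False
    then show ?thesis using that homogeneous_poly_degree[OF hom_f] by (simp add: coeff_on_line coeff_eq_0)
  qed
  then have "degree (?r f) < n" using n_pos by (metis leading_coeff_0_iff linorder_not_less degree_0)
  moreover have "?r (X - Z) dvd ?r (f - h)"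
    using div_fh by (intro on_line_dvd) (auto dest: dvd_mult_left)
  then obtain s where "?r f - ?r h = [:1, - 1:] * s" by (auto elim!: dvdE)
  from arg_cong[OF this, of "\<lambda>q. poly q 1"] have "poly (?r f) 1 = poly (?r h) 1" by simp
  ultimately show "degree (?r f) = 0"
    using deg_h f_nonzero_on_diagonal w unfolding w_def
    by (intro wronskian_dvd_power_imp_const[of "?r f" "?r h" "e + a + e"]) auto
qed

subsection \<open>Independence of \<open>z\<close>\<close>

text \<open>
  Suppose that \<open>z\<close> occurs in \<open>f\<close> or \<open>g\<close>, with highest exponent \<open>N\<close>; this turns out to be
  contradictory. The coefficients of \<open>z\<^sup>N\<close>, which have the least
  degree \<open>n - N\<close> in \<open>x\<close> and \<open>y\<close>, describe \<open>f\<close> and \<open>g\<close> to lowest order along the line \<open>x = y = 0\<close>.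
\<close>

context
  fixes N :: nat
  assumes N_pos: "N > 0" and deg_f: "degree f \<le> N" and deg_g: "degree g \<le> N"
    and top: "coeff f N \<noteq> 0 \<or> coeff g N \<noteq> 0"
begin

lemma N_less: "N < n"
proof -
  have "N \<le> degree f \<or> N \<le> degree g" using top by (auto intro: le_degree)
  then have "N \<le> n"
    using homogeneous_poly_degree[OF hom_f] homogeneous_poly_degree[OF hom_g] by auto
  moreover have "N \<noteq> n" using top coeff_f_top coeff_g_top by auto
  ultimately show ?thesis by simp
qed

lemma degree_T: "degree T \<le> N"
  using degree_X_minus_Y_power_mult[of "Suc c" T] degree_diff_le[OF deg_f deg_g]
  unfolding f_minus_g[symmetric] by simp

text \<open>
  Differentiating \<open>f\<close> or \<open>f - g\<close> by \<open>z\<close> lowers their degree in \<open>z\<close>, so that only the products without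
  such a factor contribute to the top coefficient.
\<close>

lemma degree_J: "degree J \<le> N + (N + (n - 1))"
  and top_coeff_J: "coeff J (N + (N + (n - 1))) = of_nat n * coeff h n *
     (coeff (dx f) N * coeff Ty N - coeff (dy f) N * coeff Tx N)"
proof -
  have one: "degree (of_nat (Suc c) * T) \<le> N" "degree ((X - Y) * dx T) \<le> N"
    "degree ((X - Y) * dy T) \<le> N" "degree ((X - Y) * dz T) \<le> N - 1"
    using degree_X_minus_Y_power_mult[of 1 "dx T"] degree_X_minus_Y_power_mult[of 1 "dy T"]
      degree_X_minus_Y_power_mult[of 1 "dz T"] degree_T degree_dx_le[OF degree_T]
      degree_dy_le[OF degree_T] degree_dz_le[OF degree_T]
    by (simp_all add: of_nat_poly order_trans[OF degree_smult_le] del: of_nat_Suc)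
  then have deg_T: "degree Tx \<le> N" "degree Ty \<le> N" "degree Tz \<le> N - 1"
    by (auto simp: Tx_def Ty_def Tz_def degree_minus intro!: degree_add_le degree_diff_le
        simp del: of_nat_Suc)
  have deg_h: "degree (dx h) \<le> n - 1" "degree (dy h) \<le> n - 1" "degree (dz h) \<le> n - 1"
  proof -
    have h_xy: "coeff (dx h) l = 0 \<and> coeff (dy h) l = 0" if "l \<ge> n" for l
    proof (cases "l = n")
      case True
      then show ?thesis
        by (simp add: coeff_dx coeff_dy) (subst (1 2) coeff_h, simp add: map_poly_pCons pderiv_pCons)
    next
      case False
      then show ?thesis using that homogeneous_poly_degree[OF hom_h]
        by (simp add: coeff_dx coeff_dy coeff_eq_0)
    qed
    show "degree (dx h) \<le> n - 1" by (rule degree_le) (use h_xy in auto)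
    show "degree (dy h) \<le> n - 1" by (rule degree_le) (use h_xy in auto)
    show "degree (dz h) \<le> n - 1" by (rule degree_dz_le[OF homogeneous_poly_degree[OF hom_h]])
  qed
  note deg = deg_T deg_h degree_dx_le[OF deg_f] degree_dy_le[OF deg_f] degree_dz_le[OF deg_f]
  let ?k = "N + (N + (n - 1))"
  have low: "coeff (p * (q * r)) ?k = 0"
    if "degree p \<le> i" "degree q \<le> j" "degree r \<le> l" "i + (j + l) < ?k" for p q r :: "'k poly3" and i j l
    using degree_mult_bound[OF that(1) degree_mult_bound[OF that(2,3)]] that(4)
    by (simp add: coeff_eq_0)
  have J_eq: "J = dx f * (Ty * dz h) - dy f * (Tx * dz h) - dx f * (Tz * dy h) + dy f * (Tz * dx h)
      + dz f * (Tx * dy h) - dz f * (Ty * dx h)"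
    by (simp add: J_def det3_def algebra_simps)
  have z1: "coeff (dx f * (Tz * dy h)) ?k = 0"
    by (rule low[OF deg(7,3,5)]) (use N_pos in simp)
  have z2: "coeff (dy f * (Tz * dx h)) ?k = 0"
    by (rule low[OF deg(8,3,4)]) (use N_pos in simp)
  have z3: "coeff (dz f * (Tx * dy h)) ?k = 0"
    by (rule low[OF deg(9,1,5)]) (use N_pos in simp)
  have z4: "coeff (dz f * (Ty * dx h)) ?k = 0"
    by (rule low[OF deg(9,2,4)]) (use N_pos in simp)
  have t1: "coeff (dx f * (Ty * dz h)) ?k = coeff (dx f) N * (coeff Ty N * coeff (dz h) (n - 1))"
    by (rule coeff_mult_top3[OF deg(7,2,6)])
  have t2: "coeff (dy f * (Tx * dz h)) ?k = coeff (dy f) N * (coeff Tx N * coeff (dz h) (n - 1))"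
    by (rule coeff_mult_top3[OF deg(8,1,6)])
  have hz: "coeff (dz h) (n - 1) = of_nat n * coeff h n"
    using n_pos by (simp add: coeff_dz)
  have bound: "degree (p * (q * r)) \<le> ?k"
    if "degree p \<le> i" "degree q \<le> j" "degree r \<le> l" "i + (j + l) \<le> ?k" for p q r :: "'k poly3" and i j l
    using degree_mult_bound[OF that(1) degree_mult_bound[OF that(2,3)]] that(4) by simp
  show "degree J \<le> ?k"
    unfolding J_eq
    by (intro degree_add_le degree_diff_le bound[OF deg(7,2,6)] bound[OF deg(8,1,6)]
        bound[OF deg(7,3,5)] bound[OF deg(8,3,4)] bound[OF deg(9,1,5)] bound[OF deg(9,2,4)]) simp_all
  show "coeff J ?k = of_nat n * coeff h n *
     (coeff (dx f) N * coeff Ty N - coeff (dy f) N * coeff Tx N)"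
    unfolding J_eq coeff_add coeff_diff z1 z2 z3 z4 t1 t2 hz by (simp add: algebra_simps)
qed

text \<open>
  Otherwise the difference \<open>j\<close> of both sides is, up to a constant, the leading coefficient of \<open>J\<close> in
  \<open>z\<close>. It then divides a monomial in \<open>x\<close> and \<open>y\<close>, which is not zero at \<open>x = y = 1\<close>; but \<open>j\<close> is zero there,
  because \<open>f\<close> is constant on the line \<open>x = y = 1\<close>.
\<close>

lemma initial_jacobian: "coeff (dx f) N * coeff Ty N = coeff (dy f) N * coeff Tx N"
proof (rule ccontr)
  define j where "j = coeff (dx f) N * coeff Ty N - coeff (dy f) N * coeff Tx N"
  define E where "E q = poly (poly q [:1:]) 1" for q :: "'k poly poly"
  have E [simp]: "E (p + q) = E p + E q" "E (p * q) = E p * E q" "E (p - q) = E p - E q"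
    "E (- p) = - E p" "E (p ^ k) = E p ^ k" "E 1 = 1" "E [:0, 1:] = 1" "E [:[:0, 1:]:] = 1" for p q k
    by (simp_all add: E_def)
  assume "coeff (dx f) N * coeff Ty N \<noteq> coeff (dy f) N * coeff Tx N"
  then have "j \<noteq> 0" by (simp add: j_def)
  then have "coeff J (N + (N + (n - 1))) \<noteq> 0"
    unfolding top_coeff_J j_def[symmetric] using n_pos h_top_nonzero by auto
  then have lead: "lead_coeff J = of_nat n * coeff h n * j"
    using degree_J top_coeff_J unfolding j_def by (metis le_antisym le_degree)
  have "E (coeff f N) = coeff (on_line 1 1 f) N" by (simp add: E_def coeff_on_line)
  also have "\<dots> = 0" using f_const_on_line N_pos by (simp add: coeff_eq_0)
  finally have "E (coeff (dx f) N) + E (coeff (dy f) N) = 0"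
    using arg_cong[OF homogeneous_euler_coeff[OF hom_f, of N], of E] N_less
    by (simp del: mult_pCons_left mult_pCons_right)
  then have fy: "E (coeff (dy f) N) = - E (coeff (dx f) N)" by (simp add: add_eq_0_iff)
  define w :: "'k poly poly" where "w = [:[:0, 1:]:] - [:0, 1:]"
  have w: "E w = 0" by (simp add: E_def w_def)
  have top_T: "coeff Tx N = of_nat (Suc c) * coeff T N + w * coeff (dx T) N"
    "coeff Ty N = - (of_nat (Suc c) * coeff T N) + w * coeff (dy T) N"
    using coeff_X_minus_Y_power_mult[of 1 "dx T" N] coeff_X_minus_Y_power_mult[of 1 "dy T" N]
    unfolding Tx_def Ty_def w_def coeff_add coeff_minus coeff_of_nat_mult power_one_right
    by (simp_all only:)
  have "E j = 0" unfolding j_def top_T by (simp add: fy w algebra_simps del: of_nat_Suc)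
  then have "E (lead_coeff J) = 0" unfolding lead by simp
  moreover obtain D where D: "D * J = - (F * G * (X ^ d * (X - Z) ^ e))" by (rule J_multiple)
  have "E (lead_coeff (D * J)) = E (lead_coeff D) * E (lead_coeff J)" by (simp only: lead_coeff_mult E)
  moreover have "E (lead_coeff (- (F * G * (X ^ d * (X - Z) ^ e)))) = - ((- 1) ^ e * (- 1) ^ a * (- 1) ^ e)"
  proof -
    have "lead_coeff (X :: 'k poly3) = [:[:0, 1:]:]" "lead_coeff (Y :: 'k poly3) = [:0, 1:]"
      "lead_coeff (X - Z :: 'k poly3) = - 1" "lead_coeff (Y - Z :: 'k poly3) = - 1"
      by (simp_all add: X_def Y_def Z_def)
    then show ?thesis
      unfolding F_def G_def lead_coeff_minus lead_coeff_mult lead_coeff_power by simp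
  qed
  ultimately show False unfolding D by simp
qed

lemma no_z: False
proof -
  define x y :: "'k poly poly" where "x = [:[:0, 1:]:]" and "y = [:0, 1:]"
  define p q where "p = coeff f N" and "q = coeff g N"
  define K where "K = n - N"
  have K: "K > 0" using N_less by (simp add: K_def)
  have hp: "coeff (coeff p j) i = 0" and hq: "coeff (coeff q j) i = 0" if "i + j \<noteq> K" for i j
    using that N_less unfolding p_def q_def K_def
    by (auto intro!: homogeneous_polyD[OF hom_f] homogeneous_polyD[OF hom_g])
  let ?fx = "coeff (dx f) N" and ?fy = "coeff (dy f) N"
    and ?gx = "coeff (dx g) N" and ?gy = "coeff (dy g) N"
  have "?fx - ?gx = (x - y) ^ c * coeff Tx N" "?fy - ?gy = (x - y) ^ c * coeff Ty N"
    unfolding x_def y_def coeff_X_minus_Y_power_mult[symmetric] d_f_minus_g[symmetric]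
    by (simp_all add: derivation_diff[OF derivation_dx] derivation_diff[OF derivation_dy])
  then have "?fx * (?fy - ?gy) - ?fy * (?fx - ?gx) =
      (x - y) ^ c * (?fx * coeff Ty N - ?fy * coeff Tx N)"
    by (simp only: right_diff_distrib mult.left_commute)
  then have jac: "?fx * ?gy = ?fy * ?gx" unfolding initial_jacobian by (simp add: algebra_simps)
  have euler: "x * ?fx + y * ?fy = of_nat K * p" "x * ?gx + y * ?gy = of_nat K * q"
    unfolding x_def y_def K_def p_def q_def using N_less
    by (intro homogeneous_euler_coeff hom_f hom_g; simp)+
  have "of_nat K * (p * ?gy - q * ?fy) = (x * ?fx + y * ?fy) * ?gy - (x * ?gx + y * ?gy) * ?fy"
    unfolding euler by (simp add: algebra_simps)
  also have "\<dots> = x * (?fx * ?gy - ?fy * ?gx)" by (simp add: algebra_simps)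
  also have "\<dots> = 0" unfolding jac by simp
  finally have "p * pderiv q = q * pderiv p"
    using K by (simp add: p_def q_def coeff_dy)
  then obtain s t r where r: "p = [:[:s:]:] * r" "q = [:[:t:]:] * r"
    and hr: "\<And>i j. i + j \<noteq> K \<Longrightarrow> coeff (coeff r j) i = 0"
    using forms_proportional[of K p q] hp hq by metis
  have nz: "r \<noteq> 0" "s \<noteq> 0 \<or> t \<noteq> 0" using top unfolding p_def[symmetric] q_def[symmetric] r by auto
  have const_dvd: "u dvd v" if "u dvd [:[:k:]:] * v" "k \<noteq> 0" for u v :: "'k poly poly" and k
  proof -
    have "v = [:[:inverse k:]:] * ([:[:k:]:] * v)"
      using that(2) by (simp add: one_pCons[symmetric])
    then show ?thesis using that(1) by (metis dvd_mult)
  qed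
  have "x ^ Suc d dvd p" "y ^ Suc b dvd q" "(x - y) ^ Suc c dvd p - q"
    using div_f div_g div_fg
    unfolding p_def q_def x_def y_def X_power_eq Y_power_eq X_minus_Y_power_eq coeff_diff[symmetric]
    by (simp_all only: const_poly_dvd_iff)
  moreover have "p - q = [:[:s - t:]:] * r" unfolding r by (simp add: smult_diff_left[symmetric])
  ultimately have "s \<noteq> 0 \<Longrightarrow> x ^ Suc d dvd r" "t \<noteq> 0 \<Longrightarrow> y ^ Suc b dvd r"
    "s \<noteq> t \<Longrightarrow> (x - y) ^ Suc c dvd r"
    unfolding r by (auto intro: const_dvd simp del: power_Suc mult_pCons_left)
  then obtain M r' where M: "r = M * r'" "order_ge 2 M"
    and r': "s \<noteq> 0 \<Longrightarrow> x ^ d dvd r'" "t \<noteq> 0 \<Longrightarrow> y ^ b dvd r'" "s \<noteq> t \<Longrightarrow> (x - y) ^ c dvd r'"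
    using split_off_order_two[OF nz(2), of d r b c] unfolding x_def y_def by metis
  \<comment> \<open>\<open>(P, Q, 0)\<close> is in \<open>D(A, m)\<close>, but its order along \<open>x = y = 0\<close> is at most \<open>K - 2\<close>.\<close>
  define P Q where "P = [:[:[:s:]:] * r':] * G" and "Q = [:[:[:t:]:] * r':] * G"
  have "X ^ d dvd P"
    using r'(1) unfolding P_def X_power_eq x_def
    by (cases "s = 0") (auto intro!: dvd_mult2 dvd_mult simp del: mult_pCons_left)
  moreover have "Y ^ b dvd Q"
    using r'(2) unfolding Q_def Y_power_eq y_def
    by (cases "t = 0") (auto intro!: dvd_mult2 dvd_mult simp del: mult_pCons_left)
  moreover have "P - Q = [:[:[:s - t:]:] * r':] * G"
    unfolding P_def Q_def left_diff_distrib[symmetric] by (simp add: smult_diff_left[symmetric])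
  then have "(X - Y) ^ c dvd P - Q"
    using r'(3) unfolding X_minus_Y_power_eq x_def y_def
    by (cases "s = t") (auto intro!: dvd_mult2 dvd_mult simp del: mult_pCons_left)
  moreover have "(X - Z) ^ e dvd P - 0" "(Y - Z) ^ a dvd Q - 0"
    unfolding P_def Q_def G_def by (simp_all del: mult_pCons_left)
  ultimately obtain \<chi> where \<chi>: "der_apply \<chi> f = P" "der_apply \<chi> g = Q"
    using surj[of P Q 0] by (auto simp: log_triple_def)
  define \<epsilon> :: "'k poly poly" where "\<epsilon> = (- 1) ^ e * (- 1) ^ a"
  have \<epsilon>: "\<epsilon> * \<epsilon> = 1" by (simp add: \<epsilon>_def power_mult_distrib[symmetric] mult_ac)
  have lead: "lead_coeff G = \<epsilon>"
    unfolding G_def \<epsilon>_def lead_coeff_mult lead_coeff_power by (simp add: X_def Y_def Z_def)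
  have small: "order_ge (K - 1) r'" if "k \<noteq> 0" "order_ge (K - 1) ([:[:k:]:] * r' * lead_coeff G)" for k
  proof -
    have "[:[:inverse k:]:] * \<epsilon> * ([:[:k:]:] * r' * lead_coeff G) =
        ([:[:inverse k:]:] * [:[:k:]:]) * (\<epsilon> * \<epsilon>) * r'"
      unfolding lead by (simp only: ac_simps)
    also have "\<dots> = r'" unfolding \<epsilon> using that(1) by (simp add: one_pCons[symmetric])
    finally show ?thesis using order_ge_mult_left[OF that(2)] by metis
  qed
  have "order_ge (K - 1) (coeff P l)" "order_ge (K - 1) (coeff Q l)" for l
    using order_ge_coeff_derivative[OF hom_f deg_f N_less, of \<chi> l]
      order_ge_coeff_derivative[OF hom_g deg_g N_less, of \<chi> l] unfolding \<chi> K_def by simp_all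
  from this[of "degree G"] have "order_ge (K - 1) ([:[:s:]:] * r' * lead_coeff G)"
    "order_ge (K - 1) ([:[:t:]:] * r' * lead_coeff G)"
    unfolding P_def Q_def by simp_all
  then have "order_ge (K - 1) r'" using nz(2) small by blast
  then have "order_ge (2 + (K - 1)) r" unfolding M(1) by (rule order_ge_mult[OF M(2)])
  then have "coeff (coeff r j) i = 0" for i j
    using hr[of i j] K unfolding order_ge_def by (cases "i + j = K") auto
  then have "r = 0" by (simp add: poly_eq_iff)
  then show False using nz(1) by simp
qed

end

lemma dz_f: "dz f = 0" and dz_g: "dz g = 0"
proof -
  define N where "N = max (degree f) (degree g)"
  have "N = 0"
  proof (rule ccontr)
    assume "N \<noteq> 0"
    moreover from this have "coeff f N \<noteq> 0 \<or> coeff g N \<noteq> 0"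
      using leading_coeff_0_iff[of f] leading_coeff_0_iff[of g] nonzero_f nonzero_g
      by (auto simp: N_def max_def)
    moreover have "degree f \<le> N" "degree g \<le> N" by (simp_all add: N_def)
    ultimately show False using no_z[of N] by blast
  qed
  then have "degree f = 0" "degree g = 0" by (auto simp: N_def)
  then show "dz f = 0" "dz g = 0" by (simp_all add: dz_def pderiv_eq_0_iff)
qed

lemma Tz_zero: "Tz = 0"
proof -
  have "(X - Y) ^ c * Tz = 0"
    unfolding d_f_minus_g(3)[symmetric] by (simp add: derivation_diff[OF derivation_dz] dz_f dz_g)
  then show ?thesis
    using power_not_zero[OF forms_nonzero(3), of c] by (simp only: mult_eq_0_iff) blast
qed

subsection \<open>The degree of a universal derivation\<close>

text \<open>
  The derivation \<open>\<psi>\<close> with \<open>\<psi> f = \<psi> g = 0\<close> and \<open>\<psi> h = G\<close> is a multiple \<open>w \<partial>\<^sub>z\<close>, so the derivative of \<open>h\<close>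
  by \<open>z\<close> divides \<open>G\<close>. Conversely \<open>G\<close> divides it, because \<open>f\<close> and \<open>g\<close> are free of \<open>z\<close>.
\<close>

lemma dz_h: obtains k where "is_unit k" "dz h = k * G"
proof -
  obtain \<psi> where \<psi>: "der_apply \<psi> f = 0" "der_apply \<psi> g = 0" "der_apply \<psi> h = G" by (rule obtain_G)
  obtain u v w where uvw: "\<psi> = (u, v, w)" by (cases \<psi>)
  define m where "m = dx f * Ty - dy f * Tx"
  have "J = dz h * m" by (simp add: J_def det3_def Tz_zero dz_f m_def algebra_simps)
  then have m: "m \<noteq> 0" using J_nonzero by auto
  have 1: "u * dx f + v * dy f = 0" using \<psi>(1) by (simp add: uvw der_apply_def dz_f)
  have "der_apply \<psi> (f - g) = 0" by (simp add: derivation_diff[OF derivation_der_apply] \<psi>)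
  then have "(X - Y) ^ c * (u * Tx + v * Ty) = 0"
    by (simp add: uvw der_apply_triple d_f_minus_g Tz_zero algebra_simps)
  then have 2: "u * Tx + v * Ty = 0"
    using power_not_zero[OF forms_nonzero(3), of c] by (simp only: mult_eq_0_iff) blast
  have "u * m = (u * dx f + v * dy f) * Ty - dy f * (u * Tx + v * Ty)"
    by (simp add: m_def algebra_simps)
  then have u: "u = 0" unfolding 1 2 using m by simp
  have "v * m = dx f * (u * Tx + v * Ty) - (u * dx f + v * dy f) * Tx"
    by (simp add: m_def algebra_simps)
  then have v: "v = 0" unfolding 1 2 using m by simp
  have w: "w * dz h = G" using \<psi>(3) by (simp add: uvw der_apply_def u v)
  have "dz h = - dz (f - h)" "dz h = - dz (g - h)"
    by (simp_all add: derivation_diff[OF derivation_dz] dz_f dz_g)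
  then have "(X - Z) ^ e dvd dz h" "(Y - Z) ^ a dvd dz h"
    using power_dvd_derivation[OF derivation_dz div_fh] power_dvd_derivation[OF derivation_dz div_gh]
    by (metis dvd_minus_iff)+
  then have "G dvd dz h"
    unfolding G_def by (intro prime_power_mult_dvd prime_elem_X_minus_Z not_X_minus_Z_dvd_Y_minus_Z_power)
  then obtain k where k: "dz h = G * k" by blast
  have "G * (k * w) = G * 1" using w unfolding k by (simp only: ac_simps mult_1 mult_1_right)
  moreover have "G \<noteq> 0"
    unfolding G_def by (intro no_zero_divisors power_not_zero forms_nonzero)
  ultimately have "k * w = 1" using mult_left_cancel by blast
  then have "is_unit k" by (metis dvd_triv_left)
  then show thesis using that k by (simp add: mult.commute)
qed

lemma n_eq_e_plus_a: "n = Suc (e + a)"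
proof -
  obtain k where k: "is_unit k" "dz h = k * G" by (rule dz_h)
  have "k \<noteq> 0" using k(1) by auto
  moreover have "G \<noteq> 0"
    unfolding G_def by (intro no_zero_divisors power_not_zero forms_nonzero)
  ultimately have nz: "dz h \<noteq> 0" unfolding k(2) by simp
  obtain n' where n': "n = Suc n'" using n_pos by (cases n) auto
  have "homogeneous_poly (0 + (1 * e + 1 * a)) (k * G)"
    unfolding G_def by (intro homogeneous_poly_mult homogeneous_unit_poly3 k(1) homogeneous_poly_power
        homogeneous_poly_diff homogeneous_poly_XYZ)
  moreover have "homogeneous_poly n' (k * G)"
    unfolding k(2)[symmetric] using hom_h homogeneous_poly_partials(3) by (simp add: n')
  ultimately have "e + a = n'"
    using homogeneous_poly_unique[of "0 + (1 * e + 1 * a)" "k * G" n'] nz unfolding k(2) by simp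
  then show ?thesis by (simp add: n')
qed

text \<open>
  Adding a constant multiple \<open>k P\<close> of the truncated binomial expansion to \<open>h\<close> gives a polynomial free
  of \<open>z\<close>. It is congruent to \<open>f\<close> modulo \<open>x - z\<close>, and to \<open>g + k (x - y)\<^sup>n\<close> modulo \<open>y - z\<close>; both congruences
  are equalities, since no side involves \<open>z\<close>.
\<close>

lemma f_minus_g_power: obtains k where "is_unit k" "f - g = k * (X - Y) ^ n"
proof -
  obtain k where k: "is_unit k" "dz h = k * G" by (rule dz_h)
  define P where "P = truncated_binomial e a (X - Z) (Y - Z :: 'k poly3)"
  define C :: "'k poly3" where "C = of_nat (Suc (e + a) * ((e + a) choose e)) * (- 1) ^ a"
  have "is_unit C" unfolding C_def by (rule is_unit_telescoping_constant)
  then obtain C' where C': "C * C' = 1" by (metis dvd_def)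
  define k' where "k' = k * C'"
  have "is_unit C'" using C' by (metis dvd_triv_right)
  then have k': "is_unit k'" unfolding k'_def using k(1) by (intro unit_prod)
  have "dz P = C * (- 1) * (X - Z) ^ e * (Y - Z) ^ a"
    unfolding P_def C_def
    by (rule derivation_truncated_binomial[OF derivation_dz])
      (simp_all add: derivation_diff[OF derivation_dz])
  then have "k' * dz P = - (C * C') * (k * G)" by (simp add: k'_def G_def mult_ac)
  moreover have "dz (k' * P) = k' * dz P"
    by (simp add: derivation_mult[OF derivation_dz] derivation_unit_poly3[OF k'])
  ultimately have "dz (k' * P) = - (C * C') * (k * G)" by simp
  then have dzB: "dz (h + k' * P) = 0" unfolding C' derivation_add[OF derivation_dz] k(2) by simp
  have deg: "degree (X - Z :: 'k poly3) > 0" "degree (Y - Z :: 'k poly3) > 0"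
    by (simp_all add: X_def Y_def Z_def)
  have "X - Z dvd f - h" "X - Z dvd P"
    using div_fh power_dvd_truncated_binomial[of "X - Z" e a "Y - Z :: 'k poly3"] unfolding P_def
    by (auto dest: dvd_mult_left)
  then have "X - Z dvd f - h - k' * P" by (rule dvd_diff[OF _ dvd_mult])
  also have "f - h - k' * P = f - (h + k' * P)" by simp
  finally have "f - (h + k' * P) = 0"
    by (rule dz_zero_dvd_imp_zero[rotated, OF _ deg(1)])
      (simp only: derivation_diff[OF derivation_dz] dzB dz_f diff_self)
  then have f: "f = h + k' * P" by simp
  have n: "(X - Z) - (Y - Z) = (X - Y :: 'k poly3)" by simp
  have "dz ((X - Y :: 'k poly3) ^ n) = 0"
    by (simp add: derivation_power[OF derivation_dz] derivation_diff[OF derivation_dz])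
  then have "dz (k' * (X - Y) ^ n) = 0"
    by (simp add: derivation_mult[OF derivation_dz] derivation_unit_poly3[OF k'])
  then have dz0: "dz (g - (h + k' * P) + k' * (X - Y) ^ n) = 0"
    by (simp only: derivation_diff[OF derivation_dz] derivation_add[OF derivation_dz, of "g - (h + k' * P)"]
        dzB dz_g diff_self add_0)
  have "Y - Z dvd P - (X - Y) ^ n"
    using power_dvd_truncated_binomial_minus[of "Y - Z" a e "X - Z :: 'k poly3"]
    unfolding P_def n n_eq_e_plus_a by (auto dest: dvd_mult_left)
  moreover have "Y - Z dvd g - h" using div_gh by (auto dest: dvd_mult_left)
  ultimately have "Y - Z dvd g - h - k' * (P - (X - Y) ^ n)" by (intro dvd_diff[OF _ dvd_mult])
  also have "g - h - k' * (P - (X - Y) ^ n) = g - (h + k' * P) + k' * (X - Y) ^ n"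
    by (simp add: algebra_simps)
  finally have "g - f + k' * (X - Y) ^ n = 0"
    unfolding f by (rule dz_zero_dvd_imp_zero[OF dz0 _ deg(2)])
  then have "f - g = k' * (X - Y) ^ n" by (simp add: algebra_simps)
  then show thesis by (rule that[OF k'])
qed

lemma n_eq_c: "n = Suc c"
proof -
  obtain k where k: "is_unit k" "f - g = k * (X - Y) ^ n" by (rule f_minus_g_power)
  have eq: "(X - Y) ^ Suc c * T = k * (X - Y) ^ n" using f_minus_g k(2) by simp
  have nz: "(X - Y :: 'k poly3) ^ i \<noteq> 0" for i
    by (rule power_not_zero[OF forms_nonzero(3)])
  have on_line: "on_line 1 1 ((X - Y :: 'k poly3) ^ Suc i) = 0" for i by simp
  consider "n = Suc c" | i where "n = Suc c + Suc i" | i where "Suc c = n + Suc i"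
    by (metis less_imp_Suc_add add_Suc_right linorder_neqE_nat)
  then show ?thesis
  proof cases
    case (2 i)
    have "(X - Y) ^ Suc c * T = (X - Y) ^ Suc c * (k * (X - Y) ^ Suc i)"
      unfolding eq 2 power_add by (simp only: ac_simps)
    then have "T = k * (X - Y) ^ Suc i" using nz mult_left_cancel by blast
    then have "on_line 1 1 T = 0" by (simp only: on_line_mult on_line mult_zero_right)
    then show ?thesis using T_nonzero_on_line by simp
  next
    case (3 i)
    have "(X - Y) ^ n * k = (X - Y) ^ n * ((X - Y) ^ Suc i * T)"
      using eq unfolding 3 power_add by (simp only: ac_simps)
    then have "k = (X - Y) ^ Suc i * T" using nz mult_left_cancel by blast
    then have "on_line 1 1 k = 0" by (simp only: on_line_mult on_line mult_zero_left)
    moreover have "is_unit (on_line 1 1 k)" using on_line_dvd[OF k(1), of 1 1] by simp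
    ultimately show ?thesis by simp
  qed simp
qed

lemma c_eq_a_plus_e: "c = a + e"
  using n_eq_c n_eq_e_plus_a by simp

text \<open>
  The derivation \<open>\<phi>\<close> with \<open>\<phi> f = \<phi> g = F\<close> kills \<open>(x - y)\<^sup>n\<close>, so its components at \<open>\<partial>\<^sub>x\<close> and \<open>\<partial>\<^sub>y\<close> agree, and
  \<open>s = \<partial>\<^sub>x f + \<partial>\<^sub>y f\<close> divides \<open>F\<close>. Conversely \<open>F\<close> divides \<open>s\<close>, as \<open>s\<close> is also \<open>\<partial>\<^sub>x g + \<partial>\<^sub>y g\<close>.
\<close>

lemma c_eq_b_plus_d: "c = b + d"
proof -
  obtain k where k: "is_unit k" "f - g = k * (X - Y) ^ n" by (rule f_minus_g_power)
  define s where "s = dx f + dy f"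
  obtain \<phi> where \<phi>: "der_apply \<phi> f = F" "der_apply \<phi> g = F" by (rule obtain_F)
  obtain u v w where uvw: "\<phi> = (u, v, w)" by (cases \<phi>)
  have d: "dx (f - g) = k * (of_nat n * (X - Y) ^ c)" "dy (f - g) = - (k * (of_nat n * (X - Y) ^ c))"
    unfolding k(2)
    by (simp_all add: derivation_mult[OF derivation_dx] derivation_mult[OF derivation_dy]
        derivation_unit_poly3[OF k(1)] derivation_power[OF derivation_dx]
        derivation_power[OF derivation_dy] derivation_diff[OF derivation_dx]
        derivation_diff[OF derivation_dy] n_eq_c del: of_nat_Suc power_Suc)
  have "der_apply \<phi> (f - g) = 0" by (simp add: derivation_diff[OF derivation_der_apply] \<phi>)
  then have "(k * (of_nat n * (X - Y) ^ c)) * (u - v) = 0"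
    by (simp add: uvw der_apply_triple d derivation_diff[OF derivation_dz] dz_f dz_g algebra_simps)
  moreover have "k \<noteq> 0" using k(1) by auto
  moreover have "(of_nat n :: 'k poly3) \<noteq> 0" using n_pos by (simp add: of_nat_poly)
  ultimately have "u = v" using power_not_zero[OF forms_nonzero(3), of c]
    by (simp only: mult_eq_0_iff right_minus_eq) blast
  then have us: "u * s = F" using \<phi>(1) by (simp add: uvw der_apply_def dz_f s_def distrib_left)
  have "s = dx g + dy g"
    using d by (simp add: s_def derivation_diff[OF derivation_dx] derivation_diff[OF derivation_dy]
        algebra_simps)
  then have "X ^ d dvd s" "Y ^ b dvd s"
    unfolding s_def
    using power_dvd_derivation[OF derivation_dx div_f] power_dvd_derivation[OF derivation_dy div_f]
      power_dvd_derivation[OF derivation_dx div_g] power_dvd_derivation[OF derivation_dy div_g]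
    by (metis dvd_add)+
  then have "F dvd s" unfolding F_def by (intro prime_power_mult_dvd prime_elem_X not_X_dvd_Y_power)
  then obtain l where l: "s = F * l" by blast
  have F: "F \<noteq> 0" unfolding F_def by (intro no_zero_divisors power_not_zero forms_nonzero)
  have "F * (l * u) = F * 1" using us unfolding l by (simp only: ac_simps mult_1 mult_1_right)
  then have "l * u = 1" using F mult_left_cancel by blast
  then have unit: "is_unit l" by (metis dvd_triv_left)
  have "homogeneous_poly (1 * d + 1 * b + 0) s"
    unfolding l F_def by (intro homogeneous_poly_mult homogeneous_unit_poly3 unit homogeneous_poly_power
        homogeneous_poly_XYZ)
  moreover have "homogeneous_poly c s"
    unfolding s_def using hom_f unfolding n_eq_c
    by (intro homogeneous_poly_add homogeneous_poly_partials)
  moreover have "s \<noteq> 0" using us F by auto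
  ultimately show ?thesis using homogeneous_poly_unique[of "1 * d + 1 * b + 0" s c] by simp
qed

end

section \<open>The arrangement and its linear forms\<close>

text \<open>The constants of \<open>S\<close>.\<close>

definition const3 :: "'k::field_char_0 \<Rightarrow> 'k poly3" where "const3 k = [:[:[:k:]:]:]"

lemma linear_form_eq:
  assumes "linear_form \<alpha>"
  obtains u v w where "\<alpha> = const3 u * X + const3 v * Y + const3 w * Z"
    "\<And>p q r. poly3 \<alpha> (p, q, r) = u * p + v * q + w * r"
proof -
  define u v w where "u = coeff (coeff (coeff \<alpha> 0) 0) 1" and "v = coeff (coeff (coeff \<alpha> 0) 1) 0"
    and "w = coeff (coeff (coeff \<alpha> 1) 0) 0"
  have "homogeneous_poly 1 \<alpha>" using assms by (simp add: linear_form_def)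
  from homogeneous_polyD[OF this]
  have "coeff (coeff (coeff \<alpha> l) j) i =
      coeff (coeff (coeff (const3 u * X + const3 v * Y + const3 w * Z) l) j) i" for i j l
    unfolding u_def v_def w_def
    by (cases i; cases j; cases l)
      (auto simp: const3_def X_def Y_def Z_def coeff_pCons split: nat.splits)
  then have eq: "\<alpha> = const3 u * X + const3 v * Y + const3 w * Z"
    by (intro poly_eqI) blast
  have "poly3 \<alpha> (p, q, r) = u * p + v * q + w * r" for p q r
    unfolding eq by (simp add: poly3_def const3_def X_def Y_def Z_def mult.commute)
  then show thesis using that eq by blast
qed

lemma const3_arith:
  "const3 (- k) = - const3 k" "const3 0 = 0" "const3 k * const3 l = const3 (k * l)" "const3 1 = 1"
  by (simp_all add: const3_def one_pCons)

lemma is_unit_const3: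
  assumes "k \<noteq> 0"
  shows "is_unit (const3 k)"
proof -
  have "const3 k * const3 (inverse k) = 1" using assms by (simp add: const3_arith)
  then show ?thesis by (metis dvd_triv_left)
qed

lemma proportional_forms:
  assumes "linear_form \<alpha>" "form_ker \<alpha> = form_ker L"
    and L: "L \<in> {Y - Z, Y, X - Y, X, X - Z :: 'k::field_char_0 poly3}"
  obtains k where "k \<noteq> 0" "\<alpha> = const3 k * L"
proof -
  obtain u v w where eq: "\<alpha> = const3 u * X + const3 v * Y + const3 w * Z"
    and ev: "\<And>p q r. poly3 \<alpha> (p, q, r) = u * p + v * q + w * r"
    using linear_form_eq[OF assms(1)] by metis
  have ker: "u * p + v * q + w * r = 0 \<longleftrightarrow> poly3 L (p, q, r) = 0" for p q r
    using assms(2) ev by (auto simp: form_ker_def set_eq_iff)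
  have ev_XYZ: "poly3 X (p, q, r) = p" "poly3 Y (p, q, r) = q" "poly3 (X - Y) (p, q, r) = p - q"
    "poly3 (X - Z) (p, q, r) = p - r" "poly3 (Y - Z) (p, q, r) = q - r" for p q r :: 'k
    by (simp_all add: poly3_def X_def Y_def Z_def)
  note ker' = ker[of 1 0 0] ker[of 0 1 0] ker[of 0 0 1] ker[of 1 1 0] ker[of 1 0 1] ker[of 0 1 1]
  consider "L = Y - Z" | "L = Y" | "L = X - Y" | "L = X" | "L = X - Z" using L by blast
  then show thesis
  proof cases
    case 1
    then have "u = 0" "w = - v" "v \<noteq> 0" using ker' by (auto simp: ev_XYZ eq_neg_iff_add_eq_0 add.commute)
    then show thesis using that[of v] by (simp add: eq 1 const3_arith algebra_simps)
  next
    case 2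
    then have "u = 0" "w = 0" "v \<noteq> 0" using ker' by (auto simp: ev_XYZ)
    then show thesis using that[of v] by (simp add: eq 2 const3_arith)
  next
    case 3
    then have "w = 0" "v = - u" "u \<noteq> 0" using ker' by (auto simp: ev_XYZ eq_neg_iff_add_eq_0 add.commute)
    then show thesis using that[of u] by (simp add: eq 3 const3_arith algebra_simps)
  next
    case 4
    then have "v = 0" "w = 0" "u \<noteq> 0" using ker' by (auto simp: ev_XYZ)
    then show thesis using that[of u] by (simp add: eq 4 const3_arith)
  next
    case 5
    then have "v = 0" "w = - u" "u \<noteq> 0" using ker' by (auto simp: ev_XYZ eq_neg_iff_add_eq_0 add.commute)
    then show thesis using that[of u] by (simp add: eq 5 const3_arith algebra_simps)
  qed
qed

lemma derivation_const3: "der_apply \<theta> (const3 k) = 0"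
  by (cases \<theta>) (simp add: der_apply_def const3_def dx_def dy_def dz_def map_poly_pCons pderiv_pCons)

lemma log_der_iff:
  assumes "defining_forms deleted_A3 \<alpha>"
  shows "(p, q, r) \<in> log_der deleted_A3 \<alpha> m \<longleftrightarrow>
    log_triple (m (form_ker (Y - Z))) (m (form_ker Y)) (m (form_ker (X - Y))) (m (form_ker X))
      (m (form_ker (X - Z))) p q r"
proof -
  have one: "\<alpha> (form_ker L) ^ k dvd der_apply (p, q, r) (\<alpha> (form_ker L)) \<longleftrightarrow>
      L ^ k dvd der_apply (p, q, r) L"
    if L: "L \<in> {Y - Z, Y, X - Y, X, X - Z}" for L k
  proof -
    have "form_ker L \<in> deleted_A3" using L by (auto simp: deleted_A3_def)
    then have "linear_form (\<alpha> (form_ker L))" "form_ker (\<alpha> (form_ker L)) = form_ker L"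
      using assms by (auto simp: defining_forms_def)
    then obtain s where s: "s \<noteq> 0" "\<alpha> (form_ker L) = const3 s * L"
      using proportional_forms L by metis
    have "is_unit (const3 s ^ k)" "is_unit (const3 s)"
      using is_unit_const3[OF s(1)] by (simp_all add: is_unit_power_iff)
    then show ?thesis
      unfolding s(2) derivation_mult[OF derivation_der_apply] derivation_const3 power_mult_distrib
      by (simp add: mult_unit_dvd_iff' dvd_mult_unit_iff')
  qed
  have "(p, q, r) \<in> log_der deleted_A3 \<alpha> m \<longleftrightarrow>
      (\<forall>L \<in> {Y - Z, Y, X - Y, X, X - Z}.
        \<alpha> (form_ker L) ^ m (form_ker L) dvd der_apply (p, q, r) (\<alpha> (form_ker L)))"
    by (auto simp: log_der_def deleted_A3_def)
  also have "\<dots> \<longleftrightarrow> (\<forall>L \<in> {Y - Z, Y, X - Y, X, X - Z}. L ^ m (form_ker L) dvd der_apply (p, q, r) L)"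
    using one by blast
  also have "\<dots> \<longleftrightarrow> log_triple (m (form_ker (Y - Z))) (m (form_ker Y)) (m (form_ker (X - Y)))
      (m (form_ker X)) (m (form_ker (X - Z))) p q r"
    unfolding log_triple_def
    by (simp add: derivation_diff[OF derivation_der_apply] der_apply_triple
        derivation_diff[OF derivation_dx] derivation_diff[OF derivation_dy] derivation_diff[OF derivation_dz])
  finally show ?thesis .
qed

lemma homogeneous_der_iff:
  "homogeneous_der n (f, g, h) \<longleftrightarrow> (f, g, h) \<noteq> 0 \<and>
     homogeneous_poly n f \<and> homogeneous_poly n g \<and> homogeneous_poly n h"
proof (intro iffI conjI)
  assume H: "homogeneous_der n (f, g, h)"
  then show "(f, g, h) \<noteq> 0" by (simp add: homogeneous_der_def)
  have "homogeneous_poly n (der_apply (f, g, h) \<alpha>)" if "linear_form \<alpha>" for \<alpha>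
    using H that by (cases "der_apply (f, g, h) \<alpha> = 0") (auto simp: homogeneous_der_def)
  from this[of X] this[of Y] this[of Z]
  show "homogeneous_poly n f" "homogeneous_poly n g" "homogeneous_poly n h"
    by (simp_all add: linear_form_def homogeneous_poly_XYZ[unfolded One_nat_def] der_apply_triple)
next
  assume H: "(f, g, h) \<noteq> 0 \<and> homogeneous_poly n f \<and> homogeneous_poly n g \<and> homogeneous_poly n h"
  have "homogeneous_poly n (der_apply (f, g, h) \<alpha>)" if "linear_form \<alpha>" for \<alpha>
  proof -
    have "homogeneous_poly (Suc 0) \<alpha>" using that by (simp add: linear_form_def)
    then have "homogeneous_poly 0 (dx \<alpha>)" "homogeneous_poly 0 (dy \<alpha>)" "homogeneous_poly 0 (dz \<alpha>)"
      by (rule homogeneous_poly_partials)+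
    then show ?thesis
      using H homogeneous_poly_mult[of n _ 0] by (auto simp: der_apply_triple intro!: homogeneous_poly_add)
  qed
  then show "homogeneous_der n (f, g, h)" using H by (simp add: homogeneous_der_def)
qed

lemma nabla_triple: "nabla \<chi> (f, g, h) = (der_apply \<chi> f, der_apply \<chi> g, der_apply \<chi> h)"
  by (simp add: nabla_def)

lemma der_apply_add: "der_apply (\<chi> + \<chi>') p = der_apply \<chi> p + der_apply \<chi>' p"
  by (cases \<chi>; cases \<chi>') (simp add: der_apply_def algebra_simps)

lemma der_apply_minus: "der_apply (\<chi> - \<chi>') p = der_apply \<chi> p - der_apply \<chi>' p"
  by (cases \<chi>; cases \<chi>') (simp add: der_apply_def algebra_simps)

lemma der_apply_scale: "der_apply (der_scale s \<chi>) p = s * der_apply \<chi> p"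
  by (cases \<chi>) (simp add: der_apply_def der_scale_def algebra_simps)

lemma module_hom_nabla:
  fixes \<theta> :: "'k::field_char_0 der"
  shows "module_hom der_scale der_scale (\<lambda>\<chi>. nabla \<chi> \<theta>)"
proof -
  have "module (der_scale :: 'k poly3 \<Rightarrow> 'k der \<Rightarrow> 'k der)"
    by unfold_locales (auto simp: der_scale_def algebra_simps)
  then show ?thesis
    by (cases \<theta>) (auto simp: module_hom_iff nabla_triple der_apply_add der_apply_scale,
        simp_all add: der_scale_def)
qed

theorem theorem1p5:
  fixes \<alpha> :: "'k::field_char_0 plane \<Rightarrow> 'k poly3"
    and m :: "'k plane \<Rightarrow> nat"
    and a b c d e :: nat
  assumes "defining_forms deleted_A3 \<alpha>"
    and "a = m (form_ker (Y - Z)) + 1"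
    and "b = m (form_ker Y) + 1"
    and "c = m (form_ker (X - Y)) + 1"
    and "d = m (form_ker X) + 1"
    and "e = m (form_ker (X - Z)) + 1"
  shows "(\<exists>\<theta>. universal_der deleted_A3 \<alpha> m \<theta>) \<longleftrightarrow> c = a + e - 1 \<and> a + e - 1 = b + d - 1"
proof -
  let ?a = "m (form_ker (Y - Z))" and ?b = "m (form_ker Y)" and ?c = "m (form_ker (X - Y))"
    and ?d = "m (form_ker X)" and ?e = "m (form_ker (X - Z))"
  note iff = log_der_iff[OF assms(1)]
  show ?thesis
  proof
    assume "\<exists>\<theta>. universal_der deleted_A3 \<alpha> m \<theta>"
    then obtain f g h where U: "universal_der deleted_A3 \<alpha> m (f, g, h)" by (metis prod_cases3)
    then obtain n where n: "homogeneous_der n (f, g, h)" by (auto simp: universal_der_def)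
    have log: "(f, g, h) \<in> log_der deleted_A3 \<alpha> (\<lambda>H. m H + 1)"
      and bij: "bij_betw (\<lambda>\<phi>. nabla \<phi> (f, g, h)) UNIV (log_der deleted_A3 \<alpha> m)"
      using U by (simp_all add: universal_der_def)
    interpret universal_triple ?a ?b ?c ?d ?e n f g h
    proof
      show "homogeneous_poly n f" "homogeneous_poly n g" "homogeneous_poly n h"
        using n by (simp_all add: homogeneous_der_iff)
      show "log_triple (Suc ?a) (Suc ?b) (Suc ?c) (Suc ?d) (Suc ?e) f g h"
        using log unfolding iff by simp
      fix p q r :: "'k poly3" assume "log_triple ?a ?b ?c ?d ?e p q r"
      then have "(p, q, r) \<in> range (\<lambda>\<phi>. nabla \<phi> (f, g, h))"
        using bij unfolding bij_betw_def iff[symmetric] by simp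
      then show "\<exists>\<chi>. der_apply \<chi> f = p \<and> der_apply \<chi> g = q \<and> der_apply \<chi> h = r"
        by (auto simp: nabla_triple)
    qed
    show "c = a + e - 1 \<and> a + e - 1 = b + d - 1"
      using c_eq_a_plus_e c_eq_b_plus_d assms by simp
  next
    assume "c = a + e - 1 \<and> a + e - 1 = b + d - 1"
    then have eq: "?c = ?a + ?e" "?c = ?b + ?d" using assms by auto
    obtain f g h :: "'k poly3"
      where hom: "homogeneous_poly (Suc ?c) f" "homogeneous_poly (Suc ?c) g" "homogeneous_poly (Suc ?c) h"
        and "f \<noteq> g"
        and log: "log_triple (Suc ?a) (Suc ?b) (Suc ?c) (Suc ?d) (Suc ?e) f g h"
        and surj: "\<And>p q r. log_triple ?a ?b ?c ?d ?e p q r \<Longrightarrow>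
          \<exists>\<chi>. der_apply \<chi> f = p \<and> der_apply \<chi> g = q \<and> der_apply \<chi> h = r"
        and inj: "\<And>\<chi>. der_apply \<chi> f = 0 \<Longrightarrow> der_apply \<chi> g = 0 \<Longrightarrow> der_apply \<chi> h = 0 \<Longrightarrow> \<chi> = 0"
      by (rule balanced_universal[OF eq]) blast
    have "(f, g, h) \<in> log_der deleted_A3 \<alpha> (\<lambda>H. m H + 1)"
      using log unfolding iff by simp
    moreover have "homogeneous_der (Suc ?c) (f, g, h)"
      using hom \<open>f \<noteq> g\<close> by (auto simp: homogeneous_der_iff zero_prod_def)
    moreover have "inj (\<lambda>\<phi>. nabla \<phi> (f, g, h))"
    proof (rule injI)
      fix \<phi> \<chi> assume "nabla \<phi> (f, g, h) = nabla \<chi> (f, g, h)"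
      then have "\<phi> - \<chi> = 0" by (intro inj) (simp_all add: nabla_triple der_apply_minus)
      then show "\<phi> = \<chi>" by simp
    qed
    moreover have "range (\<lambda>\<phi>. nabla \<phi> (f, g, h)) = log_der deleted_A3 \<alpha> m"
    proof (intro equalityI subsetI)
      fix \<eta> assume "\<eta> \<in> range (\<lambda>\<phi>. nabla \<phi> (f, g, h))"
      then obtain \<phi> where \<eta>: "\<eta> = (der_apply \<phi> f, der_apply \<phi> g, der_apply \<phi> h)"
        by (auto simp: nabla_triple)
      show "\<eta> \<in> log_der deleted_A3 \<alpha> m"
        using log power_dvd_derivation[OF derivation_der_apply[of \<phi>]]
        unfolding \<eta> iff log_triple_def derivation_diff[OF derivation_der_apply, symmetric] by blast
    next
      fix \<eta> assume "\<eta> \<in> log_der deleted_A3 \<alpha> m"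
      then obtain p q r where "\<eta> = (p, q, r)" "log_triple ?a ?b ?c ?d ?e p q r"
        unfolding iff[symmetric] by (cases \<eta>) auto
      then show "\<eta> \<in> range (\<lambda>\<phi>. nabla \<phi> (f, g, h))"
        using surj by (auto simp: nabla_triple image_iff) metis
    qed
    ultimately have "universal_der deleted_A3 \<alpha> m (f, g, h)"
      unfolding universal_der_def bij_betw_def using module_hom_nabla by blast
    then show "\<exists>\<theta>. universal_der deleted_A3 \<alpha> m \<theta>" by blast
  qed
qed

end
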